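(* Let $N\ge 3$, $a,b\in(0,\infty)$, and let $p_1,p_2,f_1,f_2$ satisfy (P1), (C1) and (C2) of the context, with associated data $\overline c_i,h_i,\omega_i,M_i$ and functions $P_i,Q_i,H_i$ as in the context. Assume that $H_1(\infty)=H_2(\infty)=\infty$. Then the system $$\Delta u_1=p_1(|x|)f_1(u_2),\qquad \Delta u_2=p_2(|x|)f_2(u_1)\qquad\text{for }x\in\mathbb{R}^N \qquad (\mathrm S)$$ has a nonnegative entire radial solution $(u_1,u_2)$ with central value $(a,b)$, i.e. $(u_1(0),u_2(0))=(a,b)$. Moreover: (i) If in addition $r^{2N-2}p_1(r)$ and $r^{2N-2}p_2(r)$ are nondecreasing for large $r$, and $P_2(\infty)<\infty$ and $Q_2(\infty)<\infty$ for some $\varepsilon>0$ (the same $\varepsilon$ in both), then every nonnegative entire radial solution $(u_1,u_2)$ of (S) with central value $(a,b)$ satisfies $\lim_{r\to\infty}u_1(r)<\infty$ and $\lim_{r\to\infty}u_2(r)<\infty$. (ii) If $P_1(\infty)=Q_1(\infty)=\infty$, then every nonnegative entire radial solution $(u_1,u_2)$ of (S) with central value $(a,b)$ satisfies $\lim_{r\to\infty}u_1(r)=\infty$ and $\lim_{r\to\infty}u_2(r)=\infty$. (iii) If in addition $r^{2N-2}p_1(r)$ is nondecreasing for large $r$, and $P_2(\infty)<\infty$ for some $\varepsilon>0$ and $Q_1(\infty)=\infty$, then every nonnegative entire radial solution $(u_1,u_2)$ of (S) with central value $(a,b)$ satisfies $\lim_{r\to\infty}u_1(r)<\infty$ and $\lim_{r\to\infty}u_2(r)=\infty$.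 (iv) If in addition $r^{2N-2}p_2(r)$ is nondecreasing for large $r$, and $P_1(\infty)=\infty$ and $Q_2(\infty)<\infty$ for some $\varepsilon>0$, then every nonnegative entire radial solution $(u_1,u_2)$ of (S) with central value $(a,b)$ satisfies $\lim_{r\to\infty}u_1(r)=\infty$ and $\lim_{r\to\infty}u_2(r)<\infty$. (v) If (S) has a nonnegative entire large (radial) solution $(u_1,u_2)$ with central value $(a,b)$, and $r^{2N-2}p_1(r)$, $r^{2N-2}p_2(r)$ are nondecreasing for large $r$, then $P_2(\infty)=Q_2(\infty)=\infty$ for every $\varepsilon>0$.
   Context: A radial function on $\mathbb{R}^N$ is identified with a function of $r=|x|\in[0,\infty)$. An entire radial solution of the system is a pair $(u_1,u_2)\in C^2([0,\infty))\times C^2([0,\infty))$ such that $(u_1(|x|),u_2(|x|))$ satisfies the system on all of $\mathbb{R}^N$. It is called large if $\lim_{r\to\infty}u_1(r)=\lim_{r\to\infty}u_2(r)=\infty$. Hypotheses, for given $a,b\in(0,\infty)$: (P1) $p_1,p_2:[0,\infty)\to[0,\infty)$ are continuous (the weights on $\mathbb{R}^N$ are the spherically symmetric functions $p_i(|x|)$). (C1) $f_1,f_2:[0,\infty)\to[0,\infty)$ are continuous, non-decreasing, $f_1(0)=f_2(0)=0$, and $f_1(s)>0$, $f_2(s)>0$ for all $s>0$. (C2) There exist positive constants $\overline c_1,\overline c_2$ and continuous increasing functions $h_1,h_2,\omega_1,\omega_2:[0,\infty)\to[0,\infty)$ such that $$f_1(t_1w_1)\le \overline c_1h_1(t_1)\,\omega_1(w_1)\quad\forall\,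 w_1\ge1,\ \forall\, t_1\ge M_1f_2(a),$$ $$f_2(t_2w_2)\le \overline c_2h_2(t_2)\,\omega_2(w_2)\quad\forall\, w_2\ge1,\ \forall\, t_2\ge M_2f_1(b),$$ where $M_1=b/f_2(a)$ if $b>f_2(a)$ and $M_1=1$ if $b\le f_2(a)$; $M_2=a/f_1(b)$ if $a>f_1(b)$ and $M_2=1$ if $a\le f_1(b)$. Notation (with $\varepsilon>0$ a parameter in $P_2$ and $Q_2$): $$G_1(z)=\int_0^z s^{N-1}p_2(s)\,ds,\qquad G_2(z)=\int_0^z s^{N-1}p_1(s)\,ds,$$ $$P_1(r)=\int_0^r y^{1-N}\int_0^y t^{N-1}p_1(t)f_1\Big(b+f_2(a)\int_0^t z^{1-N}G_1(z)\,dz\Big)dt\,dy,$$ $$Q_1(r)=\int_0^r y^{1-N}\int_0^y t^{N-1}p_2(t)f_2\Big(a+f_1(b)\int_0^t z^{1-N}G_2(z)\,dz\Big)dt\,dy,$$ $$P_2(r)=\int_0^r z^{1+\varepsilon}p_1(z)\,\omega_1\Big(1+\int_0^z t^{1-N}\int_0^t s^{N-1}p_2(s)\,ds\,dt\Big)dz,$$ $$Q_2(r)=\int_0^r z^{1+\varepsilon}p_2(z)\,\omega_2\Big(1+\int_0^z t^{1-N}\int_0^t s^{N-1}p_1(s)\,ds\,dt\Big)dz,$$ $$H_1(r)=\int_a^r\frac{ds}{\sqrt{\int_0^s h_1(M_1f_2(t))\,dt}},\qquad H_2(r)=\int_b^r\frac{ds}{\sqrt{\int_0^s h_2(M_2f_1(t))\,dt}},$$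 and $P_i(\infty)=\lim_{r\to\infty}P_i(r)$, $Q_i(\infty)=\lim_{r\to\infty}Q_i(r)$, $H_i(\infty)=\lim_{r\to\infty}H_i(r)$ (values in $[0,\infty]$). *)

theory Defs
  imports "HOL-Analysis.Analysis"
begin

section \<open>Radial solutions\<close>

text \<open>
  \<open>C2_halfline u\<close>: the restriction of \<open>u\<close> to the half-line is of class \<open>C\<^sup>2\<close>, with one-sided
  derivatives at \<open>0\<close>.  Values at negative arguments play no role.
\<close>

definition C2_halfline :: "(real \<Rightarrow> real) \<Rightarrow> bool" where
  "C2_halfline u \<longleftrightarrow>
     (\<exists>u' u''.
        (\<forall>r\<ge>0. (u has_real_derivative u' r) (at r within {0..})) \<and>
        (\<forall>r\<ge>0. (u' has_real_derivative u'' r) (at r within {0..})) \<and>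
        continuous_on {0..} u'')"

definition has_partial_derivative ::
    "(real ^ 'n \<Rightarrow> real) \<Rightarrow> 'n::finite \<Rightarrow> real \<Rightarrow> real ^ 'n \<Rightarrow> bool" where
  "has_partial_derivative v i d x \<longleftrightarrow>
     ((\<lambda>t. v (x + t *\<^sub>R axis i 1)) has_real_derivative d) (at 0)"

text \<open>
  The Laplacian is a relation rather than a total function, so that a pointwise equation also
  asserts the existence of the derivatives involved.  For a radial function this matters at the
  origin, where it forces \<open>u' 0 = 0\<close>.
\<close>

definition has_laplacian :: "(real ^ 'n::finite \<Rightarrow> real) \<Rightarrow> real \<Rightarrow> real ^ 'n \<Rightarrow> bool" where
  "has_laplacian v l x \<longleftrightarrow>
     (\<exists>D D2. (\<forall>i. (\<forall>\<^sub>F y in nhds x. has_partial_derivative v i (D i y) y) \<and>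
                   has_partial_derivative (D i) i (D2 i) x) \<and>
             l = (\<Sum>i\<in>UNIV. D2 i))"

text \<open>The first argument fixes the space \<open>real ^ 'n\<close> on which the system is posed.\<close>

definition entire_radial_solution ::
    "'n::finite itself \<Rightarrow> (real \<Rightarrow> real) \<Rightarrow> (real \<Rightarrow> real) \<Rightarrow> (real \<Rightarrow> real) \<Rightarrow> (real \<Rightarrow> real) \<Rightarrow>
     (real \<Rightarrow> real) \<Rightarrow> (real \<Rightarrow> real) \<Rightarrow> bool" where
  "entire_radial_solution (_ :: 'n itself) p1 p2 f1 f2 u1 u2 \<longleftrightarrow>
     C2_halfline u1 \<and> C2_halfline u2 \<and>
     (\<forall>x :: real ^ 'n.
        has_laplacian (\<lambda>y. u1 (norm y)) (p1 (norm x) * f1 (u2 (norm x))) x \<and>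
        has_laplacian (\<lambda>y. u2 (norm y)) (p2 (norm x) * f2 (u1 (norm x))) x)"

definition nonneg_solution ::
    "'n::finite itself \<Rightarrow> (real \<Rightarrow> real) \<Rightarrow> (real \<Rightarrow> real) \<Rightarrow> (real \<Rightarrow> real) \<Rightarrow> (real \<Rightarrow> real) \<Rightarrow>
     real \<Rightarrow> real \<Rightarrow> (real \<Rightarrow> real) \<Rightarrow> (real \<Rightarrow> real) \<Rightarrow> bool" where
  "nonneg_solution T p1 p2 f1 f2 a b u1 u2 \<longleftrightarrow>
     entire_radial_solution T p1 p2 f1 f2 u1 u2 \<and>
     (\<forall>r\<ge>0. 0 \<le> u1 r \<and> 0 \<le> u2 r) \<and> u1 0 = a \<and> u2 0 = b"

definition has_finite_limit :: "(real \<Rightarrow> real) \<Rightarrow> bool" where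
  "has_finite_limit g \<longleftrightarrow> (\<exists>L. (g \<longlongrightarrow> L) at_top)"

definition has_infinite_limit :: "(real \<Rightarrow> real) \<Rightarrow> bool" where
  "has_infinite_limit g \<longleftrightarrow> filterlim g at_top at_top"

definition large :: "(real \<Rightarrow> real) \<Rightarrow> (real \<Rightarrow> real) \<Rightarrow> bool" where
  "large u1 u2 \<longleftrightarrow> has_infinite_limit u1 \<and> has_infinite_limit u2"


section \<open>Auxiliary quantities\<close>

text \<open>
  At \<open>y = 0\<close> the factor \<open>y powi (1 - int N)\<close> has the conventional value \<open>0\<close> for \<open>N > 1\<close>; this is
  a single point of the integration domain and does not affect the integrals.
\<close>

definition M1 :: "(real \<Rightarrow> real) \<Rightarrow> real \<Rightarrow> real \<Rightarrow> real" where
  "M1 f2 a b = (if b > f2 a then b / f2 a else 1)"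

definition M2 :: "(real \<Rightarrow> real) \<Rightarrow> real \<Rightarrow> real \<Rightarrow> real" where
  "M2 f1 a b = (if a > f1 b then a / f1 b else 1)"

definition G1 :: "nat \<Rightarrow> (real \<Rightarrow> real) \<Rightarrow> real \<Rightarrow> real" where
  "G1 N p2 z = integral {0..z} (\<lambda>s. s ^ (N - 1) * p2 s)"

definition G2 :: "nat \<Rightarrow> (real \<Rightarrow> real) \<Rightarrow> real \<Rightarrow> real" where
  "G2 N p1 z = integral {0..z} (\<lambda>s. s ^ (N - 1) * p1 s)"

definition P1 ::
    "nat \<Rightarrow> (real \<Rightarrow> real) \<Rightarrow> (real \<Rightarrow> real) \<Rightarrow> (real \<Rightarrow> real) \<Rightarrow> (real \<Rightarrow> real) \<Rightarrow>
     real \<Rightarrow> real \<Rightarrow> real \<Rightarrow> real" where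
  "P1 N p1 p2 f1 f2 a b r =
     integral {0..r} (\<lambda>y. y powi (1 - int N) *
       integral {0..y} (\<lambda>t. t ^ (N - 1) * p1 t *
         f1 (b + f2 a * integral {0..t} (\<lambda>z. z powi (1 - int N) * G1 N p2 z))))"

definition Q1 ::
    "nat \<Rightarrow> (real \<Rightarrow> real) \<Rightarrow> (real \<Rightarrow> real) \<Rightarrow> (real \<Rightarrow> real) \<Rightarrow> (real \<Rightarrow> real) \<Rightarrow>
     real \<Rightarrow> real \<Rightarrow> real \<Rightarrow> real" where
  "Q1 N p1 p2 f1 f2 a b r =
     integral {0..r} (\<lambda>y. y powi (1 - int N) *
       integral {0..y} (\<lambda>t. t ^ (N - 1) * p2 t *
         f2 (a + f1 b * integral {0..t} (\<lambda>z. z powi (1 - int N) * G2 N p1 z))))"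

definition P2 ::
    "nat \<Rightarrow> (real \<Rightarrow> real) \<Rightarrow> (real \<Rightarrow> real) \<Rightarrow> (real \<Rightarrow> real) \<Rightarrow> real \<Rightarrow> real \<Rightarrow> real" where
  "P2 N p1 p2 \<omega>1 \<epsilon> r =
     integral {0..r} (\<lambda>z. z powr (1 + \<epsilon>) * p1 z *
       \<omega>1 (1 + integral {0..z} (\<lambda>t. t powi (1 - int N) *
                 integral {0..t} (\<lambda>s. s ^ (N - 1) * p2 s))))"

definition Q2 ::
    "nat \<Rightarrow> (real \<Rightarrow> real) \<Rightarrow> (real \<Rightarrow> real) \<Rightarrow> (real \<Rightarrow> real) \<Rightarrow> real \<Rightarrow> real \<Rightarrow> real" where
  "Q2 N p1 p2 \<omega>2 \<epsilon> r =
     integral {0..r} (\<lambda>z. z powr (1 + \<epsilon>) * p2 z *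
       \<omega>2 (1 + integral {0..z} (\<lambda>t. t powi (1 - int N) *
                 integral {0..t} (\<lambda>s. s ^ (N - 1) * p1 s))))"

definition H1 :: "(real \<Rightarrow> real) \<Rightarrow> (real \<Rightarrow> real) \<Rightarrow> real \<Rightarrow> real \<Rightarrow> real \<Rightarrow> real" where
  "H1 h1 f2 a b r =
     integral {a..r} (\<lambda>s. 1 / sqrt (integral {0..s} (\<lambda>t. h1 (M1 f2 a b * f2 t))))"

definition H2 :: "(real \<Rightarrow> real) \<Rightarrow> (real \<Rightarrow> real) \<Rightarrow> real \<Rightarrow> real \<Rightarrow> real \<Rightarrow> real" where
  "H2 h2 f1 a b r =
     integral {b..r} (\<lambda>s. 1 / sqrt (integral {0..s} (\<lambda>t. h2 (M2 f1 a b * f1 t))))"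

definition weight_nondecreasing_for_large :: "nat \<Rightarrow> (real \<Rightarrow> real) \<Rightarrow> bool" where
  "weight_nondecreasing_for_large N p \<longleftrightarrow> (\<exists>R. mono_on {R..} (\<lambda>r. r ^ (2 * N - 2) * p r))"

end

theory Submission
  imports Defs
begin

text \<open>
  Radial solutions are exactly the solutions of the integral system
  \<open>u\<^sub>1 = a + \<Phi> (p\<^sub>1 f\<^sub>1(u\<^sub>2))\<close>, \<open>u\<^sub>2 = b + \<Phi> (p\<^sub>2 f\<^sub>2(u\<^sub>1))\<close>, where \<open>\<Phi>\<close> inverts the radial Laplacian.
  Monotonicity and (C2) decouple it: \<open>u\<^sub>2 \<le> M\<^sub>1 f\<^sub>2(u\<^sub>1) w\<close> with \<open>w = 1 + \<Phi> p\<^sub>2\<close>, so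
  \<open>\<Delta> u\<^sub>1 \<le> c\<^sub>1 p\<^sub>1 \<omega>\<^sub>1(w) k(u\<^sub>1)\<close> with \<open>k = h\<^sub>1 \<circ> M\<^sub>1 f\<^sub>2\<close>.  Multiplying by \<open>u\<^sub>1'\<close> bounds \<open>u\<^sub>1'\<close> by a
  multiple of \<open>\<surd>(K(u\<^sub>1))\<close>, \<open>K' = k\<close>, hence \<open>H\<^sub>1(u\<^sub>1)\<close> on compact intervals; as
  \<open>H\<^sub>1(\<infinity>) = \<infinity>\<close>, the monotone iterates are locally bounded and converge to a solution.  When
  \<open>r\<^bsup>2N-2\<^esup> p\<^sub>1\<close> is eventually nondecreasing, multiplying \<open>(r\<^bsup>N-1\<^esup> u\<^sub>1')'\<close> by \<open>r\<^bsup>N-1\<^esup> u\<^sub>1'\<close> instead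
  shows that \<open>H\<^sub>1(u\<^sub>1)\<close> grows at most like the integral of
  \<open>r\<^bsup>1-N\<^esup> + \<surd>(p\<^sub>1 \<omega>\<^sub>1(w))\<close>, which AM-GM bounds by \<open>P\<^sub>2\<close>.  Conversely \<open>u\<^sub>1 \<ge> a\<close> gives
  \<open>u\<^sub>2 \<ge> b + f\<^sub>2(a) \<Phi> p\<^sub>2\<close>, hence \<open>u\<^sub>1 \<ge> P\<^sub>1\<close>.
\<close>

section \<open>Radial Poisson problem\<close>

text \<open>\<open>flux N g\<close> and \<open>potential N g\<close> are \<open>u'\<close> and \<open>u\<close> for the radial solution of \<open>\<Delta> u = g\<close>, \<open>u 0 = 0\<close>,
  in dimension \<open>N\<close>.\<close>

definition flux :: "nat \<Rightarrow> (real \<Rightarrow> real) \<Rightarrow> real \<Rightarrow> real" where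
  "flux N g y = y powi (1 - int N) * integral {0..y} (\<lambda>t. t ^ (N - 1) * g t)"

definition potential :: "nat \<Rightarrow> (real \<Rightarrow> real) \<Rightarrow> real \<Rightarrow> real" where
  "potential N g r = integral {0..r} (flux N g)"

lemma powi_one_minus:
  assumes "N \<ge> 1"
  shows "(y::real) powi (1 - int N) = inverse (y ^ (N - 1))"
proof -
  have "1 - int N = - int (N - 1)" using assms by simp
  then show ?thesis by (metis power_int_minus power_int_of_nat)
qed

lemma flux_0 [simp]: "flux N g 0 = 0"
  by (simp add: flux_def)

lemma potential_0 [simp]: "potential N g 0 = 0"
  by (simp add: potential_def)

lemma integrable_on_moment:
  fixes g :: "real \<Rightarrow> real"
  assumes "continuous_on {0..} g"
  shows "(\<lambda>t. t ^ n * g t) integrable_on {0..y}"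
  by (intro integrable_continuous_interval continuous_intros continuous_on_subset[OF assms]) auto

lemma flux_mono:
  assumes "continuous_on {0..} g" "continuous_on {0..} k"
    and "\<And>t. 0 \<le> t \<Longrightarrow> t \<le> y \<Longrightarrow> g t \<le> k t" "0 \<le> y"
  shows "flux N g y \<le> flux N k y"
  unfolding flux_def
  using assms
  by (intro mult_left_mono integral_le integrable_on_moment) (auto intro: mult_left_mono)

text \<open>The non-integrable case is covered by the default value \<open>0\<close> of
  \<open>integral\<close>.\<close>

lemma integral_nonneg_pointwise:
  fixes f :: "real \<Rightarrow> real"
  assumes "\<And>x. x \<in> S \<Longrightarrow> 0 \<le> f x"
  shows "0 \<le> integral S f"
  by (cases "f integrable_on S") (auto simp: not_integrable_integral intro: integral_nonneg assms)

lemma flux_nonneg: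
  assumes "\<And>t. 0 \<le> t \<Longrightarrow> t \<le> y \<Longrightarrow> 0 \<le> g t" "0 \<le> y"
  shows "0 \<le> flux N g y"
  unfolding flux_def using assms by (intro mult_nonneg_nonneg integral_nonneg_pointwise) auto

lemma flux_cmult: "flux N (\<lambda>t. c * g t) y = c * flux N g y"
proof -
  have "(\<lambda>t. t ^ (N - 1) * (c * g t)) = (\<lambda>t. c * (t ^ (N - 1) * g t))"
    by (simp only: mult.left_commute)
  then show ?thesis
    by (simp only: flux_def integral_mult_right mult.left_commute)
qed

lemma flux_const:
  assumes "N \<ge> 1" "0 \<le> y"
  shows "flux N (\<lambda>_. c) y = c * y / N"
proof -
  have "((\<lambda>t. t ^ (N - 1)) has_integral (y ^ N / N - 0 ^ N / N)) {0..y}"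
    using assms
    by (intro fundamental_theorem_of_calculus)
      (auto intro!: derivative_eq_intros simp: has_real_derivative_iff_has_vector_derivative[symmetric])
  then have "integral {0..y} (\<lambda>t. t ^ (N - 1)) = y ^ N / N"
    using assms by (auto simp: integral_unique)
  moreover have "y ^ N = y * y ^ (N - 1)"
    using assms by (cases N) auto
  ultimately show ?thesis
    using assms by (auto simp: flux_def powi_one_minus)
qed

lemma flux_diff:
  assumes "continuous_on {0..} g" "continuous_on {0..} k"
  shows "flux N (\<lambda>t. g t - k t) y = flux N g y - flux N k y"
  by (simp add: flux_def right_diff_distrib integral_diff integrable_on_moment assms)

lemma flux_abs_le:
  assumes "N \<ge> 1" "continuous_on {0..} g" "0 \<le> y"
    and "\<And>t. 0 \<le> t \<Longrightarrow> t \<le> y \<Longrightarrow> \<bar>g t\<bar> \<le> B"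
  shows "\<bar>flux N g y\<bar> \<le> B * y"
proof -
  have "flux N g y \<le> flux N (\<lambda>_. B) y" "flux N (\<lambda>_. - B) y \<le> flux N g y"
    using assms by (auto intro!: flux_mono simp: abs_le_iff) (metis minus_le_iff)
  then have "\<bar>flux N g y\<bar> \<le> B * y / N"
    using assms by (simp add: flux_const abs_le_iff)
  moreover have "0 \<le> B" using assms(4)[of 0] assms(3) by auto
  then have "B * y / N \<le> B * y / 1"
    using assms by (intro divide_left_mono) auto
  ultimately show ?thesis by simp
qed

section \<open>Differentiability of flux and potential\<close>

lemma moment_has_derivative:
  assumes "continuous_on {0..} g" "0 < r"
  shows "((\<lambda>y. integral {0..y} (\<lambda>t. t ^ n * g t)) has_real_derivative r ^ n * g r) (at r)"
proof -
  have "((\<lambda>y. integral {0..y} (\<lambda>t. t ^ n * g t)) has_vector_derivative r ^ n * g r)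
      (at r within {0..r+1})"
    by (rule integral_has_vector_derivative)
      (use assms in \<open>auto intro!: continuous_intros continuous_on_subset[OF assms(1)]\<close>)
  then show ?thesis
    using assms(2) at_within_interior[of r "{0..r+1}"]
    by (auto simp: has_real_derivative_iff_has_vector_derivative)
qed

text \<open>This is the radial equation \<open>u'' + (N - 1) / r * u' = g\<close> solved for
  \<open>u''\<close>. In the product rule the power of \<open>y\<close> yields the damping term and
  the moment integral yields \<open>g\<close>.\<close>

lemma flux_has_derivative:
  assumes "N \<ge> 1" "continuous_on {0..} g" "0 < r"
  shows "(flux N g has_real_derivative g r - (real N - 1) / r * flux N g r) (at r)"
proof -
  obtain n where n: "N = Suc n" using assms(1) by (cases N) auto
  let ?J = "\<lambda>y. integral {0..y} (\<lambda>t. t ^ n * g t)"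
  have eq: "flux N g = (\<lambda>y. inverse (y ^ n) * ?J y)"
    by (rule ext, subst flux_def, subst powi_one_minus) (auto simp: n)
  have "real n * r ^ (n - 1) = real n * r ^ n / r"
    using assms(3) by (cases n) auto
  then have "- (inverse (r ^ n) * (real n * r ^ (n - 1)) * inverse (r ^ n)) * ?J r
      + inverse (r ^ n) * (r ^ n * g r) = g r - (real N - 1) / r * (inverse (r ^ n) * ?J r)"
    using assms(3) by (auto simp: n field_simps)
  moreover have "((\<lambda>y. inverse (y ^ n) * ?J y) has_real_derivative
      - (inverse (r ^ n) * (real n * r ^ (n - 1)) * inverse (r ^ n)) * ?J r
        + inverse (r ^ n) * (r ^ n * g r)) (at r)"
    using assms(3)
    by (auto intro!: derivative_eq_intros moment_has_derivative[OF assms(2,3)])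
  ultimately show ?thesis
    unfolding eq by simp
qed

text \<open>The formula for positive radii is singular at the origin. Freezing the source at
  \<open>g 0\<close> leaves a remainder that is small near \<open>0\<close> by continuity, and
  \<open>flux_abs_le\<close> makes its flux small compared with \<open>y\<close>.\<close>

lemma flux_has_derivative_0:
  assumes "N \<ge> 1" "continuous_on {0..} g"
  shows "(flux N g has_real_derivative g 0 / N) (at 0 within {0..})"
  unfolding has_field_derivative_iff
proof (rule tendstoI)
  fix e :: real assume "e > 0"
  then have "e / 2 > 0" by simp
  from assms(2) have "continuous (at 0 within {0..}) g"
    by (simp add: continuous_on_eq_continuous_within)
  then obtain d where d: "d > 0" "\<And>t. t \<in> {0..} \<Longrightarrow> dist t 0 < d \<Longrightarrow> dist (g t) (g 0) < e/2"
    using \<open>e / 2 > 0\<close> unfolding continuous_within_eps_delta by metis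
  have "dist ((flux N g y - flux N g 0) / (y - 0)) (g 0 / N) < e" if "0 < y" "y < d" for y
  proof -
    have "\<bar>flux N (\<lambda>t. g t - g 0) y\<bar> \<le> e/2 * y"
      using assms d that
      by (intro flux_abs_le continuous_intros) (auto simp: dist_real_def less_imp_le)
    then have "\<bar>flux N g y - g 0 * y / N\<bar> \<le> e/2 * y"
      using assms that by (subst (asm) flux_diff) (auto simp: flux_const intro!: continuous_intros)
    moreover have "(flux N g y - flux N g 0) / (y - 0) - g 0 / N = (flux N g y - g 0 * y / N) / y"
      using that assms by (simp add: field_simps)
    ultimately have "\<bar>(flux N g y - flux N g 0) / (y - 0) - g 0 / N\<bar> \<le> e / 2"
      using that by (simp add: abs_divide pos_divide_le_eq)
    then show ?thesis using \<open>e > 0\<close> unfolding dist_real_def by linarith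
  qed
  then show "\<forall>\<^sub>F y in at 0 within {0..}. dist ((flux N g y - flux N g 0) / (y - 0)) (g 0 / N) < e"
    using d(1) by (auto simp: eventually_at dist_real_def intro!: exI[of _ d])
qed

lemma flux_continuous_on:
  assumes "N \<ge> 1" "continuous_on {0..} g"
  shows "continuous_on {0..} (flux N g)"
proof -
  have "continuous (at r within {0..}) (flux N g)" if "r \<ge> 0" for r
  proof (cases "r = 0")
    case True
    then show ?thesis using DERIV_continuous[OF flux_has_derivative_0[OF assms]] by simp
  next
    case False
    then have "isCont (flux N g) r"
      using that by (intro DERIV_isCont[OF flux_has_derivative[OF assms]]) auto
    then show ?thesis by (simp add: continuous_at_imp_continuous_at_within)
  qed
  then show ?thesis by (simp add: continuous_on_eq_continuous_within)
qed

lemma flux_integrable_on: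
  assumes "N \<ge> 1" "continuous_on {0..} g"
  shows "flux N g integrable_on {0..r}"
  by (intro integrable_continuous_interval continuous_on_subset[OF flux_continuous_on[OF assms]]) auto

lemma integral_has_derivative_halfline:
  fixes F :: "real \<Rightarrow> real"
  assumes "continuous_on {a..} F" "a \<le> r"
  shows "((\<lambda>r. integral {a..r} F) has_real_derivative F r) (at r within {a..})"
proof -
  have "((\<lambda>r. integral {a..r} F) has_vector_derivative F r) (at r within {a..r+1})"
    by (rule integral_has_vector_derivative)
      (use assms in \<open>auto intro: continuous_on_subset\<close>)
  moreover have "at r within {a..r+1} = at r within {a..}"
    by (rule at_within_nhd[of _ "{..<r+1}"]) auto
  ultimately show ?thesis
    by (simp add: has_real_derivative_iff_has_vector_derivative)
qed

lemma potential_has_derivative: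
  assumes "N \<ge> 1" "continuous_on {0..} g" "r \<ge> 0"
  shows "(potential N g has_real_derivative flux N g r) (at r within {0..})"
  using integral_has_derivative_halfline[OF flux_continuous_on[OF assms(1,2)] assms(3)]
  by (simp add: potential_def[abs_def])

lemma potential_continuous_on:
  assumes "N \<ge> 1" "continuous_on {0..} g"
  shows "continuous_on {0..} (potential N g)"
  unfolding continuous_on_eq_continuous_within
  using DERIV_continuous[OF potential_has_derivative[OF assms]] by simp

lemma potential_mono:
  assumes "N \<ge> 1" "continuous_on {0..} g" "continuous_on {0..} k"
    and "\<And>t. 0 \<le> t \<Longrightarrow> t \<le> r \<Longrightarrow> g t \<le> k t"
  shows "potential N g r \<le> potential N k r"
  unfolding potential_def
  using assms by (intro integral_le flux_integrable_on flux_mono) auto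

lemma potential_nonneg:
  assumes "\<And>t. 0 \<le> t \<Longrightarrow> 0 \<le> g t"
  shows "0 \<le> potential N g r"
  unfolding potential_def using assms by (intro integral_nonneg_pointwise) (auto intro: flux_nonneg)

lemma potential_cmult: "potential N (\<lambda>t. c * g t) r = c * potential N g r"
proof -
  have "flux N (\<lambda>t. c * g t) = (\<lambda>y. c * flux N g y)"
    by (rule ext) (rule flux_cmult)
  then show ?thesis
    by (simp add: potential_def)
qed

lemma potential_mono_arg:
  assumes "N \<ge> 1" "continuous_on {0..} g" "\<And>t. 0 \<le> t \<Longrightarrow> 0 \<le> g t" "0 \<le> r" "r \<le> s"
  shows "potential N g r \<le> potential N g s"
  unfolding potential_def
proof (rule integral_subset_le)
  show "flux N g integrable_on {0..r}" "flux N g integrable_on {0..s}"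
    by (rule flux_integrable_on[OF assms(1,2)])+
  show "\<forall>x\<in>{0..s}. 0 \<le> flux N g x"
  proof
    fix x assume "x \<in> {0..s}"
    then show "0 \<le> flux N g x"
      by (intro flux_nonneg assms(3)) simp_all
  qed
  show "{0..r} \<subseteq> {0..s}"
    using assms(5) by simp
qed

text \<open>The second derivative is given the value \<open>g 0 / N\<close> at \<open>0\<close>. It
  is continuous there because \<open>flux N g r / r\<close> tends to \<open>g 0 / N\<close>, so the
  expression for positive radii tends to \<open>g 0 - (N - 1) * (g 0 / N)\<close>.\<close>

lemma C2_halfline_potential:
  assumes "N \<ge> 1" "continuous_on {0..} g"
  shows "C2_halfline (\<lambda>r. a + potential N g r)"
proof -
  define u2 where "u2 r = (if r = 0 then g 0 / N else g r - (real N - 1) / r * flux N g r)" for r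
  have "(flux N g has_real_derivative u2 r) (at r within {0..})" if "r \<ge> 0" for r
    using flux_has_derivative_0[OF assms] flux_has_derivative[OF assms, of r] that
    by (auto simp: u2_def has_field_derivative_at_within)
  moreover have "continuous (at r within {0..}) u2" if "r \<ge> 0" for r
  proof (cases "r = 0")
    case True
    have "((\<lambda>r. flux N g r / r) \<longlongrightarrow> g 0 / N) (at 0 within {0..})"
      using flux_has_derivative_0[OF assms] by (simp add: has_field_derivative_iff)
    moreover have "(g \<longlongrightarrow> g 0) (at 0 within {0..})"
      using assms(2) by (simp add: continuous_on_def)
    ultimately have "((\<lambda>r. g r - (real N - 1) * (flux N g r / r)) \<longlongrightarrow> g 0 - (real N - 1) * (g 0 / N))
        (at 0 within {0..})"
      by (intro tendsto_diff tendsto_mult_left)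
    moreover have "g 0 - (real N - 1) * (g 0 / N) = u2 0"
      using assms(1) by (simp add: u2_def field_simps)
    moreover have "\<forall>\<^sub>F r in at 0 within {0..}. g r - (real N - 1) * (flux N g r / r) = u2 r"
      by (auto simp: u2_def eventually_at intro!: exI[of _ 1])
    ultimately have "(u2 \<longlongrightarrow> u2 0) (at 0 within {0..})"
      using Lim_transform_eventually[of "\<lambda>r. g r - (real N - 1) * (flux N g r / r)"] by simp
    then show ?thesis using True by (simp add: continuous_within)
  next
    case False
    have "continuous_on {0<..} (\<lambda>r. g r - (real N - 1) / r * flux N g r)"
      by (intro continuous_intros continuous_on_subset[OF assms(2)]
          continuous_on_subset[OF flux_continuous_on[OF assms]]) auto
    then have "continuous_on {0<..} u2"
      by (rule continuous_on_eq) (auto simp: u2_def)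
    then have "isCont u2 r"
      using False that by (simp add: continuous_on_eq_continuous_at)
    then show ?thesis by (rule continuous_at_imp_continuous_at_within)
  qed
  moreover have "((\<lambda>r. a + potential N g r) has_real_derivative flux N g r) (at r within {0..})"
    if "r \<ge> 0" for r
    using DERIV_add[OF DERIV_const potential_has_derivative[OF assms that]] by simp
  ultimately show ?thesis
    unfolding C2_halfline_def continuous_on_eq_continuous_within
    by (intro exI[of _ "flux N g"] exI[of _ u2]) simp
qed

text \<open>The factor \<open>r ^ (N - 1)\<close> is integrating: \<open>r ^ (N - 1) * v r\<close>
  has derivative \<open>r ^ (N - 1) * g r\<close>. As \<open>N \<ge> 2\<close> and \<open>v\<close>
  is continuous at \<open>0\<close>, the boundary term vanishes, which excludes the homogeneous
  solution \<open>r powi (1 - N)\<close>.\<close>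

lemma flux_eqI:
  assumes "N \<ge> 2" "continuous_on {0..} g" "continuous_on {0..} v"
    and "\<And>r. r > 0 \<Longrightarrow> (v has_real_derivative g r - (real N - 1) / r * v r) (at r)"
    and "0 \<le> r"
  shows "v r = flux N g r"
proof -
  obtain n where n: "N = Suc n" "n > 0" using assms(1) by (cases N) auto
  have *: "v r = flux N g r" if "r > 0" for r
  proof -
    have "((\<lambda>t. t ^ n * g t) has_integral r ^ n * v r - 0 ^ n * v 0) {0..r}"
    proof (rule fundamental_theorem_of_calculus_interior)
      show "continuous_on {0..r} (\<lambda>t. t ^ n * v t)"
        by (intro continuous_intros continuous_on_subset[OF assms(3)]) auto
      fix t :: real assume t: "t \<in> {0<..<r}"
      have "t ^ n = t * t ^ (n - 1)" using n by (cases n) auto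
      with t have "((\<lambda>t. t ^ n * v t) has_real_derivative t ^ n * g t) (at t)"
        by (auto intro!: derivative_eq_intros assms(4) simp: n field_simps)
      then show "((\<lambda>t. t ^ n * v t) has_vector_derivative t ^ n * g t) (at t)"
        by (simp add: has_real_derivative_iff_has_vector_derivative)
    qed (use that in auto)
    then have "integral {0..r} (\<lambda>t. t ^ n * g t) = r ^ n * v r"
      using n by (auto simp: integral_unique)
    moreover have "flux N g r = inverse (r ^ n) * integral {0..r} (\<lambda>t. t ^ n * g t)"
      using n by (subst flux_def, subst powi_one_minus) auto
    ultimately show ?thesis
      using that by simp
  qed
  show ?thesis
  proof (cases "r = 0")
    case True
    \<comment> \<open>The identity is known for positive radii; its value at \<open>0\<close>
      follows from continuity of both sides.\<close>
    have "(v \<longlongrightarrow> v 0) (at_right 0)"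
      using assms(3) by (simp add: continuous_on_def flip: at_within_Ici_at_right)
    moreover have "(flux N g \<longlongrightarrow> flux N g 0) (at 0 within {0..})"
      using flux_continuous_on[OF _ assms(2), of N] assms(1)
      by (auto simp: continuous_on_def simp del: flux_0)
    then have "(flux N g \<longlongrightarrow> flux N g 0) (at_right 0)"
      by (simp add: at_within_Ici_at_right)
    moreover have "\<forall>\<^sub>F r in at_right 0. flux N g r = v r"
      using * by (auto simp: eventually_at intro!: exI[of _ 1])
    ultimately have "(v \<longlongrightarrow> flux N g 0) (at_right 0)"
      using Lim_transform_eventually by blast
    with \<open>(v \<longlongrightarrow> v 0) (at_right 0)\<close> show ?thesis
      using True tendsto_unique[OF trivial_limit_at_right_real] by blast
  qed (use * assms(5) in auto)
qed

section \<open>Laplacian of radial functions\<close>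

lemma norm_plus_axis_has_derivative:
  fixes x :: "real ^ 'n::finite"
  assumes "x \<noteq> 0"
  shows "((\<lambda>t. norm (x + t *\<^sub>R axis i 1)) has_real_derivative x $ i / norm x) (at 0)"
proof -
  have "((\<lambda>t. norm (x + t *\<^sub>R axis i 1)) has_derivative (\<lambda>h. (h *\<^sub>R axis i 1) \<bullet> sgn x)) (at 0)"
  proof (rule has_derivative_compose[where g = norm])
    show "((\<lambda>t. x + t *\<^sub>R axis i 1) has_derivative (\<lambda>h. h *\<^sub>R axis i 1)) (at 0)"
      by (auto intro!: derivative_eq_intros)
    show "(norm has_derivative (\<lambda>y. y \<bullet> sgn x)) (at (x + 0 *\<^sub>R axis i 1))"
      using has_derivative_norm[OF assms] by simp
  qed
  moreover have "(\<lambda>h. (h *\<^sub>R axis i 1) \<bullet> sgn x) = (*) (x $ i / norm x)"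
    by (auto simp: sgn_div_norm inner_axis' field_simps)
  ultimately show ?thesis
    by (simp add: has_field_derivative_def)
qed

lemma has_partial_derivative_radial:
  fixes x :: "real ^ 'n::finite"
  assumes "x \<noteq> 0" "(u has_real_derivative d) (at (norm x))"
  shows "has_partial_derivative (\<lambda>y. u (norm y)) i (d * (x $ i / norm x)) x"
  unfolding has_partial_derivative_def
  by (rule DERIV_chain'[OF norm_plus_axis_has_derivative[OF assms(1)]]) (use assms in simp)

lemma has_derivative_at_of_halfline:
  fixes u :: "real \<Rightarrow> real"
  assumes "(u has_real_derivative d) (at r within {0..})" "r > 0"
  shows "(u has_real_derivative d) (at r)"
  using assms at_within_interior[of r "{0..}"] by (simp add: interior_real_atLeast)

text \<open>Along an axis the function is \<open>u \<bar>t\<bar>\<close>, whose difference quotient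
  is that of \<open>u\<close> at \<open>\<bar>t\<bar>\<close> up to sign. Since the limit is
  \<open>0\<close>, the sign is harmless, hence the detour through absolute values.\<close>

lemma has_partial_derivative_radial_0:
  assumes "(u has_real_derivative 0) (at 0 within {0..})"
  shows "has_partial_derivative (\<lambda>y. u (norm y)) i 0 (0 :: real ^ 'n::finite)"
proof -
  have lim: "((\<lambda>r. (u r - u 0) / r) \<longlongrightarrow> 0) (at 0 within {0..})"
    using assms by (simp add: has_field_derivative_iff)
  have "filterlim (\<lambda>t::real. \<bar>t\<bar>) (at 0 within {0..}) (at 0)"
    unfolding filterlim_at by (auto simp: eventually_at intro!: tendsto_eq_intros exI[of _ 1])
  from filterlim_compose[OF lim this] have "((\<lambda>t. (u \<bar>t\<bar> - u 0) / \<bar>t\<bar>) \<longlongrightarrow> 0) (at 0)" .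
  then have "((\<lambda>t. \<bar>(u \<bar>t\<bar> - u 0) / \<bar>t\<bar>\<bar>) \<longlongrightarrow> 0) (at 0)"
    by (rule tendsto_rabs_zero)
  then have "((\<lambda>t. \<bar>(u \<bar>t\<bar> - u 0) / t\<bar>) \<longlongrightarrow> 0) (at 0)"
    by (simp add: abs_divide)
  then have "((\<lambda>t. (u \<bar>t\<bar> - u 0) / t) \<longlongrightarrow> 0) (at 0)"
    by (rule tendsto_rabs_zero_cancel)
  then show ?thesis
    by (simp add: has_partial_derivative_def has_field_derivative_iff norm_axis_1)
qed

text \<open>Away from \<open>0\<close> the chain rule gives the pure second derivatives, and the
  terms \<open>(x $ i)\<^sup>2\<close> sum to the squared norm. At \<open>0\<close> every pure
  second derivative is \<open>w 0\<close>, whence the factor \<open>CARD('n)\<close>.\<close>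

lemma has_laplacian_radial:
  fixes x :: "real ^ 'n::finite" and u v w :: "real \<Rightarrow> real"
  assumes u: "\<And>r. r \<ge> 0 \<Longrightarrow> (u has_real_derivative v r) (at r within {0..})"
    and v: "\<And>r. r \<ge> 0 \<Longrightarrow> (v has_real_derivative w r) (at r within {0..})"
    and v0: "v 0 = 0"
  shows "has_laplacian (\<lambda>y. u (norm y))
    (if x = 0 then real CARD('n) * w 0 else w (norm x) + (real CARD('n) - 1) / norm x * v (norm x)) x"
proof -
  \<comment> \<open>At \<open>y = 0\<close> the quotient is \<open>0\<close> by the convention for
    division, so \<open>D i 0 = 0\<close> is the correct first derivative there.\<close>
  define D where "D i y = v (norm y) * (y $ i / norm y)" for i :: 'n and y :: "real ^ 'n"
  define D2 where "D2 i = (if x = 0 then w 0 else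
      w (norm x) * (x $ i / norm x)\<^sup>2 + v (norm x) * (1 / norm x - (x $ i)\<^sup>2 / norm x ^ 3))" for i
  have "has_partial_derivative (\<lambda>y. u (norm y)) i (D i y) y" for i y
  proof (cases "y = 0")
    case True
    then show ?thesis
      using u[of 0] v0 by (simp add: D_def has_partial_derivative_radial_0)
  next
    case False
    then show ?thesis
      unfolding D_def
      by (intro has_partial_derivative_radial has_derivative_at_of_halfline[OF u]) auto
  qed
  moreover have "has_partial_derivative (D i) i (D2 i) x" for i
  proof (cases "x = 0")
    case True
    have lim: "((\<lambda>r. v r / r) \<longlongrightarrow> w 0) (at 0 within {0..})"
      using v[of 0] v0 by (simp add: has_field_derivative_iff)
    have "filterlim (\<lambda>t::real. \<bar>t\<bar>) (at 0 within {0..}) (at 0)"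
      unfolding filterlim_at by (auto simp: eventually_at intro!: tendsto_eq_intros exI[of _ 1])
    from filterlim_compose[OF lim this] have "((\<lambda>t. v \<bar>t\<bar> / \<bar>t\<bar>) \<longlongrightarrow> w 0) (at 0)" .
    moreover have "\<forall>\<^sub>F t in at 0. v \<bar>t\<bar> / \<bar>t\<bar> = (D i (0 + t *\<^sub>R axis i 1) - D i 0) / t"
      by (auto simp: eventually_at D_def v0 norm_axis_1 intro!: exI[of _ 1])
    ultimately have "((\<lambda>t. (D i (0 + t *\<^sub>R axis i 1) - D i 0) / t) \<longlongrightarrow> w 0) (at 0)"
      by (rule Lim_transform_eventually)
    then show ?thesis
      using True by (simp add: has_partial_derivative_def has_field_derivative_iff D2_def)
  next
    case False
    let ?r = "\<lambda>t. norm (x + t *\<^sub>R axis i 1)"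
    have dr: "(?r has_real_derivative x $ i / norm x) (at 0)"
      by (rule norm_plus_axis_has_derivative[OF False])
    have dv: "((\<lambda>t. v (?r t)) has_real_derivative w (norm x) * (x $ i / norm x)) (at 0)"
      by (rule DERIV_chain'[OF dr])
        (use False in \<open>auto intro!: has_derivative_at_of_halfline v\<close>)
    have dq: "((\<lambda>t. (x $ i + t) / ?r t) has_real_derivative
        (norm x - x $ i * (x $ i / norm x)) / (norm x * norm x)) (at 0)"
      using False by (auto intro!: derivative_eq_intros dr)
    have "((\<lambda>t. v (?r t) * ((x $ i + t) / ?r t)) has_real_derivative D2 i) (at 0)"
      by (rule DERIV_cong[OF DERIV_mult[OF dv dq]])
        (use False in \<open>simp add: D2_def field_simps power2_eq_square power3_eq_cube\<close>)
    then show ?thesis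
      by (simp add: has_partial_derivative_def D_def)
  qed
  moreover have "(if x = 0 then real CARD('n) * w 0
      else w (norm x) + (real CARD('n) - 1) / norm x * v (norm x)) = (\<Sum>i\<in>UNIV. D2 i)"
  proof (cases "x = 0")
    case True
    then show ?thesis by (simp add: D2_def)
  next
    case False
    have s: "(\<Sum>i\<in>UNIV. (x $ i)\<^sup>2) = (norm x)\<^sup>2"
      unfolding power2_norm_eq_inner by (simp add: inner_vec_def power2_eq_square)
    have "(\<Sum>i\<in>UNIV. D2 i) = w (norm x) / (norm x)\<^sup>2 * (\<Sum>i\<in>UNIV. (x $ i)\<^sup>2)
        + v (norm x) * (CARD('n) / norm x - (\<Sum>i\<in>UNIV. (x $ i)\<^sup>2) / norm x ^ 3)"
      using False by (simp add: D2_def sum.distrib sum_subtractf sum_distrib_left sum_divide_distrib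
          power_divide right_diff_distrib)
    also have "\<dots> = w (norm x) + (real CARD('n) - 1) / norm x * v (norm x)"
      unfolding s using False by (simp add: field_simps power2_eq_square power3_eq_cube)
    finally show ?thesis using False by simp
  qed
  ultimately show ?thesis
    unfolding has_laplacian_def by (intro exI[of _ D] exI[of _ D2]) simp
qed

text \<open>Uniqueness of derivatives makes two choices of first partial derivatives agree on a
  neighbourhood of \<open>x\<close>, so their own partial derivatives at \<open>x\<close> coincide
  as well.\<close>

lemma has_laplacian_unique:
  assumes "has_laplacian f l x" "has_laplacian f l' x"
  shows "l = l'"
proof -
  obtain D D2 where D: "\<And>i. \<forall>\<^sub>F y in nhds x. has_partial_derivative f i (D i y) y"
      "\<And>i. has_partial_derivative (D i) i (D2 i) x" "l = (\<Sum>i\<in>UNIV. D2 i)"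
    using assms(1) unfolding has_laplacian_def by blast
  obtain E E2 where E: "\<And>i. \<forall>\<^sub>F y in nhds x. has_partial_derivative f i (E i y) y"
      "\<And>i. has_partial_derivative (E i) i (E2 i) x" "l' = (\<Sum>i\<in>UNIV. E2 i)"
    using assms(2) unfolding has_laplacian_def by blast
  have "D2 i = E2 i" for i
  proof -
    have "\<forall>\<^sub>F y in nhds x. D i y = E i y"
      using D(1)[of i] E(1)[of i]
      by eventually_elim (auto simp: has_partial_derivative_def intro: DERIV_unique)
    moreover have "((\<lambda>t. x + t *\<^sub>R axis i 1) \<longlongrightarrow> x) (nhds 0)"
      using isCont_def tendsto_at_iff_tendsto_nhds
      by (auto intro!: tendsto_eq_intros filterlim_ident)
    ultimately have "\<forall>\<^sub>F t in nhds 0. D i (x + t *\<^sub>R axis i 1) = E i (x + t *\<^sub>R axis i 1)"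
      by (rule eventually_compose_filterlim)
    then have "((\<lambda>t. E i (x + t *\<^sub>R axis i 1)) has_real_derivative D2 i) (at 0)"
      using D(2)[of i] by (simp add: has_partial_derivative_def DERIV_cong_ev)
    then show ?thesis
      using E(2)[of i] by (auto simp: has_partial_derivative_def intro: DERIV_unique)
  qed
  then show ?thesis by (simp add: D(3) E(3))
qed

text \<open>The function \<open>u \<bar>t\<bar>\<close> is even, so its derivative at
  \<open>0\<close> equals its own negative. Its right-hand difference quotient is that of
  \<open>u\<close>, whose one-sided derivative must therefore vanish.\<close>

lemma radial_partial_derivative_at_0:
  assumes "has_partial_derivative (\<lambda>y. u (norm y)) i d (0 :: real ^ 'n::finite)"
    and "(u has_real_derivative v) (at 0 within {0..})"
  shows "v = 0"
proof -
  have d: "((\<lambda>t. u \<bar>t\<bar>) has_real_derivative d) (at 0)"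
    using assms(1) by (simp add: has_partial_derivative_def norm_axis_1)
  have "((\<lambda>t. u \<bar>- t\<bar>) has_real_derivative d * (- 1)) (at 0)"
    by (rule DERIV_chain'[of uminus "-1" 0]) (use d in \<open>auto intro!: derivative_eq_intros\<close>)
  then have "((\<lambda>t. u \<bar>t\<bar>) has_real_derivative d * (- 1)) (at 0)"
    by (simp only: abs_minus_cancel)
  with d have "d = d * (- 1)"
    by (rule DERIV_unique)
  then have "d = 0" by simp
  have "((\<lambda>t. u \<bar>t\<bar>) has_real_derivative d) (at 0 within {0..})"
    using d by (rule has_field_derivative_at_within)
  then have "(u has_real_derivative d) (at 0 within {0..})"
    by (rule has_field_derivative_transform_within[where d = 1]) auto
  then have "((\<lambda>r. (u r - u 0) / r) \<longlongrightarrow> d) (at_right 0)" "((\<lambda>r. (u r - u 0) / r) \<longlongrightarrow> v) (at_right 0)"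
    using assms(2) by (simp_all add: has_field_derivative_iff flip: at_within_Ici_at_right)
  then show ?thesis
    using \<open>d = 0\<close> tendsto_unique[OF trivial_limit_at_right_real] by blast
qed

lemma potential_has_laplacian:
  fixes x :: "real ^ 'n::finite"
  assumes "continuous_on {0..} g"
  shows "has_laplacian (\<lambda>y. a + potential CARD('n) g (norm y)) (g (norm x)) x"
proof -
  \<comment> \<open>The value at \<open>0\<close> is chosen so that
    \<open>CARD('n) * w 0 = g 0\<close>.\<close>
  define w where "w r = (if r = 0 then g 0 / CARD('n)
      else g r - (real CARD('n) - 1) / r * flux CARD('n) g r)" for r
  have N: "CARD('n) \<ge> 1" by (simp add: Suc_leI)
  have "has_laplacian (\<lambda>y. a + potential CARD('n) g (norm y))
    (if x = 0 then real CARD('n) * w 0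
     else w (norm x) + (real CARD('n) - 1) / norm x * flux CARD('n) g (norm x)) x"
  proof (rule has_laplacian_radial[where v = "flux CARD('n) g" and w = w])
    show "((\<lambda>r. a + potential CARD('n) g r) has_real_derivative flux CARD('n) g r) (at r within {0..})"
      if "r \<ge> 0" for r
      using DERIV_add[OF DERIV_const potential_has_derivative[OF N assms that]] by simp
    show "(flux CARD('n) g has_real_derivative w r) (at r within {0..})" if "r \<ge> 0" for r
      using flux_has_derivative_0[OF N assms] flux_has_derivative[OF N assms, of r] that
      by (auto simp: w_def has_field_derivative_at_within)
  qed simp
  then show ?thesis by (auto simp: w_def split: if_splits)
qed

text \<open>Uniqueness of the Laplacian turns the equation on the space into the first-order
  equation of \<open>flux_eqI\<close> for \<open>u'\<close>. One more integration identifies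
  \<open>u\<close> up to its value at \<open>0\<close>.\<close>

lemma radial_solution_eq_potential:
  assumes "CARD('n::finite) \<ge> 2" "C2_halfline u" "continuous_on {0..} g"
    and lap: "\<And>x :: real ^ 'n. has_laplacian (\<lambda>y. u (norm y)) (g (norm x)) x"
    and "r \<ge> 0"
  shows "u r = u 0 + potential CARD('n) g r"
proof -
  have N: "CARD('n) \<ge> 1" using assms(1) by simp
  obtain v w where
    u: "\<And>r. r \<ge> 0 \<Longrightarrow> (u has_real_derivative v r) (at r within {0..})" and
    v: "\<And>r. r \<ge> 0 \<Longrightarrow> (v has_real_derivative w r) (at r within {0..})"
    using assms(2) unfolding C2_halfline_def by blast
  obtain D where D: "\<And>i. \<forall>\<^sub>F y :: real ^ 'n in nhds 0. has_partial_derivative (\<lambda>y. u (norm y)) i (D i y) y"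
    using lap[of 0] unfolding has_laplacian_def by blast
  have v0: "v 0 = 0"
    using radial_partial_derivative_at_0[OF eventually_nhds_x_imp_x[OF D] u[of 0]] by simp
  have flux: "v r = flux CARD('n) g r" if "r \<ge> 0" for r
  proof (rule flux_eqI[OF assms(1,3) _ _ that])
    show "continuous_on {0..} v"
      unfolding continuous_on_eq_continuous_within using DERIV_continuous[OF v] by simp
    fix r :: real assume "r > 0"
    \<comment> \<open>By radial symmetry any direction serves, so the axis index is
      arbitrary.\<close>
    define x :: "real ^ 'n" where "x = r *\<^sub>R axis undefined 1"
    have x: "norm x = r" "x \<noteq> 0" using \<open>r > 0\<close> by (auto simp: x_def norm_axis_1 axis_eq_0_iff)
    have "w r + (real CARD('n) - 1) / r * v r = g r"
      using has_laplacian_unique[OF has_laplacian_radial[OF u v v0] lap[of x]] x by simp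
    then have "w r = g r - (real CARD('n) - 1) / r * v r"
      by simp
    then show "(v has_real_derivative g r - (real CARD('n) - 1) / r * v r) (at r)"
      using has_derivative_at_of_halfline[OF v[of r]] \<open>r > 0\<close> by simp
  qed
  have "((\<lambda>r. u r - potential CARD('n) g r) has_real_derivative 0) (at r within {0..})"
    if "r \<in> {0..}" for r
    using DERIV_diff[OF u potential_has_derivative[OF N assms(3)], of r] that flux by simp
  then obtain c where "\<And>r. r \<in> {0..} \<Longrightarrow> u r - potential CARD('n) g r = c"
    using has_field_derivative_zero_constant[of "{0..}" "\<lambda>r. u r - potential CARD('n) g r"] by auto
  from this[of 0] this[of r] assms(5) show ?thesis by simp
qed

section \<open>Energy estimates\<close>

lemma primitive_pos:
  fixes k :: "real \<Rightarrow> real"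
  assumes "continuous_on {0..} k" "\<And>t. t > 0 \<Longrightarrow> 0 < k t" "0 < s"
  shows "0 < integral {0..s} k"
proof -
  have "integral {0..0} k < integral {0..s} k"
  proof (rule DERIV_pos_imp_increasing_open[OF assms(3)])
    show "\<exists>y. ((\<lambda>s. integral {0..s} k) has_real_derivative y) (at t) \<and> 0 < y"
      if "0 < t" "t < s" for t
      using has_derivative_at_of_halfline[OF integral_has_derivative_halfline[OF assms(1)]] assms(2) that
      by (meson less_imp_le)
    show "continuous_on {0..s} (\<lambda>s. integral {0..s} k)"
      by (intro indefinite_integral_continuous_1 integrable_continuous_interval
          continuous_on_subset[OF assms(1)]) auto
  qed
  then show ?thesis by simp
qed

lemma primitive_continuous_on:
  fixes k :: "real \<Rightarrow> real"
  assumes "continuous_on {a..} k"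
  shows "continuous_on {a..} (\<lambda>s. integral {a..s} k)"
  unfolding continuous_on_eq_continuous_within
  using DERIV_continuous[OF integral_has_derivative_halfline[OF assms]] by simp

lemma primitive_mono:
  fixes k :: "real \<Rightarrow> real"
  assumes "continuous_on {0..} k" "\<And>t. t \<ge> 0 \<Longrightarrow> 0 \<le> k t" "s \<le> t"
  shows "integral {0..s} k \<le> integral {0..t} k"
  using assms
  by (intro integral_subset_le integrable_continuous_interval continuous_on_subset[OF assms(1)]) auto

text \<open>The function \<open>H\<close> of the theorem linearises the inequality \<open>u' \<le> q \<surd>(K u)\<close>.\<close>

lemma integral_inverse_sqrt_comparison:
  fixes u v Q q K :: "real \<Rightarrow> real"
  assumes K: "continuous_on {a..} K" "\<And>s. s \<ge> a \<Longrightarrow> 0 < K s"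
    and u: "continuous_on {R..r} u" "\<And>x. x \<in> {R..r} \<Longrightarrow> a \<le> u x"
      "\<And>x. x \<in> {R<..<r} \<Longrightarrow> (u has_real_derivative v x) (at x)"
    and Q: "continuous_on {R..r} Q" "\<And>x. x \<in> {R<..<r} \<Longrightarrow> (Q has_real_derivative q x) (at x)"
    and le: "\<And>x. x \<in> {R<..<r} \<Longrightarrow> v x \<le> q x * sqrt (K (u x))"
    and "R \<le> r"
  shows "integral {a..u r} (\<lambda>s. 1 / sqrt (K s)) - Q r \<le> integral {a..u R} (\<lambda>s. 1 / sqrt (K s)) - Q R"
proof -
  define H where "H s = integral {a..s} (\<lambda>s. 1 / sqrt (K s))" for s
  have "K s \<noteq> 0" if "s \<ge> a" for s using K(2)[OF that] by simp
  then have cont: "continuous_on {a..} (\<lambda>s. 1 / sqrt (K s))"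
    by (intro continuous_intros K(1)) auto
  have H: "(H has_real_derivative 1 / sqrt (K s)) (at s within {a..})" if "a \<le> s" for s
    using integral_has_derivative_halfline[OF cont that] by (simp add: H_def[abs_def])
  have "continuous_on {a..} H"
    unfolding H_def by (rule primitive_continuous_on[OF cont])
  then have Hu: "continuous_on {R..r} (\<lambda>x. H (u x))"
    by (rule continuous_on_compose2[OF _ u(1)]) (use u(2) in auto)
  have dHu: "((\<lambda>x. H (u x)) has_real_derivative 1 / sqrt (K (u x)) * v x) (at x)"
    if "x \<in> {R<..<r}" for x
  proof -
    \<comment> \<open>\<open>H\<close> is differentiable only within \<open>{a..}\<close>, and
      \<open>u x\<close> may equal \<open>a\<close>. The chain rule is therefore taken within the
      image of \<open>u\<close>, which lies in that half-line; openness of \<open>{R<..<r}\<close>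
      then restores the full derivative.\<close>
    have "(u has_real_derivative v x) (at x within {R<..<r})"
      using u(3)[OF that] by (rule has_field_derivative_at_within)
    moreover have "(H has_real_derivative 1 / sqrt (K (u x))) (at (u x) within u ` {R<..<r})"
      by (rule DERIV_subset[OF H]) (use u(2) that in auto)
    ultimately have "(H \<circ> u has_real_derivative 1 / sqrt (K (u x)) * v x) (at x within {R<..<r})"
      by (rule DERIV_image_chain[rotated])
    then show ?thesis
      using that at_within_open[of x "{R<..<r}"] by (simp add: o_def)
  qed
  have "H (u r) - Q r \<le> H (u R) - Q R"
  proof (rule DERIV_nonpos_imp_decreasing_open[OF assms(9)])
    show "continuous_on {R..r} (\<lambda>x. H (u x) - Q x)"
      by (intro continuous_intros Hu Q(1))
    fix x assume "R < x" "x < r"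
    then have x: "x \<in> {R<..<r}" by simp
    have "1 / sqrt (K (u x)) * v x - q x \<le> 0"
      using le[OF x] K(2)[OF u(2)[of x]] x by (simp add: divide_le_eq)
    then show "\<exists>y. ((\<lambda>x. H (u x) - Q x) has_real_derivative y) (at x) \<and> y \<le> 0"
      using DERIV_diff[OF dHu[OF x] Q(2)[OF x]] by blast
  qed
  then show ?thesis by (simp add: H_def)
qed

text \<open>Divergence bounds the sublevel sets of \<open>H\<close> from above. This turns a bound
  on \<open>H (u r)\<close> into a bound on \<open>u r\<close> without an inverse of
  \<open>H\<close>.\<close>

lemma has_infinite_limit_bound:
  assumes "has_infinite_limit H"
  shows "\<exists>B. \<forall>s. H s \<le> C \<longrightarrow> s \<le> B"
proof -
  from assms have "\<forall>\<^sub>F s in at_top. C < H s"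
    unfolding has_infinite_limit_def by (simp add: filterlim_at_top_dense)
  then show ?thesis
    unfolding eventually_at_top_linorder by (metis le_cases not_le)
qed

lemma primitive_potential_has_derivative:
  fixes k :: "real \<Rightarrow> real"
  assumes "N \<ge> 1" "continuous_on {0..} g" "\<And>t. t \<ge> 0 \<Longrightarrow> 0 \<le> g t" "a > 0"
    and "continuous_on {0..} k" "r > 0"
  shows "((\<lambda>r. integral {0..a + potential N g r} k) has_real_derivative
    k (a + potential N g r) * flux N g r) (at r)"
proof -
  have "((\<lambda>r. a + potential N g r) has_real_derivative flux N g r) (at r)"
    using DERIV_add[OF DERIV_const has_derivative_at_of_halfline[OF potential_has_derivative[OF assms(1,2)]]]
      assms(6) by simp
  moreover have "a + potential N g r > 0"
    using potential_nonneg[of g N r] assms(3,4) by simp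
  then have "((\<lambda>s. integral {0..s} k) has_real_derivative k (a + potential N g r)) (at (a + potential N g r))"
    by (intro has_derivative_at_of_halfline integral_has_derivative_halfline assms(5)) auto
  ultimately show ?thesis
    by (rule DERIV_chain2[rotated])
qed

lemma primitive_potential_continuous_on:
  fixes k :: "real \<Rightarrow> real"
  assumes "N \<ge> 1" "continuous_on {0..} g" "\<And>t. t \<ge> 0 \<Longrightarrow> 0 \<le> g t" "a > 0" "continuous_on {0..} k"
  shows "continuous_on {0..} (\<lambda>r. integral {0..a + potential N g r} k)"
proof (rule continuous_on_compose2[OF primitive_continuous_on[OF assms(5)]])
  show "continuous_on {0..} (\<lambda>r. a + potential N g r)"
    by (intro continuous_intros potential_continuous_on assms)
  show "(\<lambda>r. a + potential N g r) ` {0..} \<subseteq> {0..}"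
    using potential_nonneg[of g N] assms(3,4) by (auto intro!: add_nonneg_nonneg)
qed

text \<open>With \<open>u = a + potential N g\<close> and \<open>K\<close> the primitive of
  \<open>k\<close>, the energy \<open>u'\<^sup>2 - 2 * A * K u\<close> is nonincreasing: the damping
  has a favourable sign and the source is dominated by \<open>A * k u\<close>. At
  \<open>r = 0\<close> the energy is at most \<open>0\<close>, because \<open>u'\<close> vanishes
  there.\<close>

lemma flux_energy_bound:
  fixes k :: "real \<Rightarrow> real"
  assumes "N \<ge> 1" "continuous_on {0..} g" "\<And>t. t \<ge> 0 \<Longrightarrow> 0 \<le> g t" "a > 0"
    and "continuous_on {0..} k" "\<And>t. t \<ge> 0 \<Longrightarrow> 0 \<le> k t"
    and "\<And>t. 0 \<le> t \<Longrightarrow> t \<le> r \<Longrightarrow> g t \<le> A * k (a + potential N g t)" "0 \<le> A" "0 \<le> r"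
  shows "(flux N g r)\<^sup>2 \<le> 2 * A * integral {0..a + potential N g r} k"
proof -
  \<comment> \<open>Here \<open>F\<close> stands for the flux, \<open>G\<close> for the source,
    \<open>Y\<close> for the damping term and \<open>K\<close> for the value of
    \<open>k\<close>.\<close>
  have energy: "2 * F * (G - Y) - 2 * A * (K * F) \<le> 0" if "F * (G - A * K) \<le> 0" "0 \<le> F * Y"
    for F G Y K :: real
  proof -
    have "2 * F * (G - Y) - 2 * A * (K * F) = 2 * (F * (G - A * K) - F * Y)"
      by (simp add: algebra_simps)
    also have "F * (G - A * K) \<le> F * Y"
      using that by (rule order_trans)
    finally show ?thesis by simp
  qed
  let ?E = "\<lambda>r. (flux N g r)\<^sup>2 - 2 * A * integral {0..a + potential N g r} k"
  have "?E r \<le> ?E 0"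
  proof (rule DERIV_nonpos_imp_decreasing_open[OF assms(9)])
    show "continuous_on {0..r} ?E"
      by (intro continuous_intros continuous_on_subset[OF flux_continuous_on[OF assms(1,2)]]
          continuous_on_subset[OF primitive_potential_continuous_on[OF assms(1-5)]]) auto
    fix x assume x: "0 < x" "x < r"
    let ?d = "2 * flux N g x * (g x - (real N - 1) / x * flux N g x)
      - 2 * A * (k (a + potential N g x) * flux N g x)"
    have "(?E has_real_derivative ?d) (at x)"
      by (auto intro!: derivative_eq_intros flux_has_derivative[OF assms(1,2)]
          primitive_potential_has_derivative[OF assms(1-5)] simp: x)
    have "0 \<le> flux N g x" using x assms(3) by (intro flux_nonneg) auto
    then have "flux N g x * (g x - A * k (a + potential N g x)) \<le> 0"
      "0 \<le> flux N g x * ((real N - 1) / x * flux N g x)"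
      using assms(1) assms(7)[of x] x by (auto intro!: mult_nonneg_nonpos mult_nonneg_nonneg)
    then have "?d \<le> 0" by (rule energy)
    with \<open>(?E has_real_derivative ?d) (at x)\<close> show "\<exists>y. (?E has_real_derivative y) (at x) \<and> y \<le> 0" by blast
  qed
  moreover have "0 \<le> 2 * A * integral {0..a} k"
    using assms by (intro mult_nonneg_nonneg integral_nonneg_pointwise) auto
  ultimately show ?thesis by simp
qed

text \<open>The weight absorbs the damping, since \<open>r ^ (N - 1) * u'\<close> has derivative
  \<open>r ^ (N - 1) * g\<close>. Monotonicity of \<open>m\<close> lets its value at the right
  endpoint dominate it on all of \<open>{R..r}\<close>.\<close>

lemma flux_weighted_energy_bound:
  fixes k :: "real \<Rightarrow> real"
  assumes "N \<ge> 1" "continuous_on {0..} g" "\<And>t. t \<ge> 0 \<Longrightarrow> 0 \<le> g t" "a > 0"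
    and "continuous_on {0..} k" "\<And>t. t \<ge> 0 \<Longrightarrow> 0 \<le> k t"
    and "R > 0" "mono_on {R..} m" "0 \<le> m R"
    and g: "\<And>t. R \<le> t \<Longrightarrow> t ^ (2 * N - 2) * g t \<le> m t * k (a + potential N g t)"
    and "R \<le> r"
  shows "(r ^ (N - 1) * flux N g r)\<^sup>2
    \<le> (R ^ (N - 1) * flux N g R)\<^sup>2 + 2 * m r * integral {0..a + potential N g r} k"
proof -
  obtain n where n: "N = Suc n" using assms(1) by (cases N) auto
  \<comment> \<open>The coefficient is frozen at \<open>m r\<close>, so that \<open>m\<close> itself
    is never differentiated.\<close>
  let ?E = "\<lambda>t. (t ^ n * flux N g t)\<^sup>2 - 2 * m r * integral {0..a + potential N g t} k"
  have "?E r \<le> ?E R"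
  proof (rule DERIV_nonpos_imp_decreasing_open[OF assms(11)])
    show "continuous_on {R..r} ?E"
      using assms(7)
      by (intro continuous_intros continuous_on_subset[OF flux_continuous_on[OF assms(1,2)]]
          continuous_on_subset[OF primitive_potential_continuous_on[OF assms(1-5)]]) auto
    fix x assume x: "R < x" "x < r"
    with assms(7) have "x > 0" by simp
    let ?d = "2 * (x ^ n * flux N g x) * (x ^ n * g x) - 2 * m r * (k (a + potential N g x) * flux N g x)"
    have "real n * x ^ (n - 1) = real n * x ^ n / x"
      using \<open>x > 0\<close> by (cases n) auto
    then have eq: "real n * x ^ (n - Suc 0) * flux N g x + (g x - (real N - 1) / x * flux N g x) * x ^ n
        = x ^ n * g x"
      by (simp add: n) (simp add: algebra_simps)
    have "((\<lambda>t. t ^ n * flux N g t) has_real_derivative x ^ n * g x) (at x)"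
      by (rule DERIV_cong[OF DERIV_mult[OF DERIV_pow flux_has_derivative[OF assms(1,2) \<open>x > 0\<close>]] eq])
    moreover have "((\<lambda>t. (F t)\<^sup>2 - 2 * m r * J t) has_real_derivative 2 * F x * F' - 2 * m r * J') (at x)"
      if "(F has_real_derivative F') (at x)" "(J has_real_derivative J') (at x)" for F J F' J'
      using that by (auto intro!: derivative_eq_intros)
    ultimately have "(?E has_real_derivative ?d) (at x)"
      using primitive_potential_has_derivative[OF assms(1-5) \<open>x > 0\<close>] by blast
    moreover have "x ^ (2 * N - 2) * g x \<le> m r * k (a + potential N g x)"
    proof -
      have "m x \<le> m r" using assms(8) x by (auto simp: mono_on_def)
      moreover have "0 \<le> k (a + potential N g x)"
        using potential_nonneg[of g N x] assms(3,4) by (intro assms(6)) auto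
      ultimately have "m x * k (a + potential N g x) \<le> m r * k (a + potential N g x)"
        by (rule mult_right_mono)
      with g[of x] x show ?thesis by simp
    qed
    moreover have "0 \<le> flux N g x" using \<open>x > 0\<close> assms(3) by (intro flux_nonneg) auto
    ultimately have "flux N g x * (x ^ (2 * N - 2) * g x - m r * k (a + potential N g x)) \<le> 0"
      by (auto intro!: mult_nonneg_nonpos)
    then have "?d \<le> 0" by (simp add: algebra_simps n power_mult power2_eq_square power_mult_distrib)
    then show "\<exists>y. (?E has_real_derivative y) (at x) \<and> y \<le> 0"
      using \<open>(?E has_real_derivative ?d) (at x)\<close> by blast
  qed
  moreover have "0 \<le> m r"
    using assms(8,9,11) by (force simp: mono_on_def)
  then have "0 \<le> 2 * m R * integral {0..a + potential N g R} k" "0 \<le> 2 * m r * integral {0..a + potential N g R} k"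
    using assms by (intro mult_nonneg_nonneg integral_nonneg_pointwise; auto)+
  ultimately show ?thesis by (simp add: n)
qed

lemma real_le_sqrt_add:
  fixes x y z :: real
  assumes "x\<^sup>2 \<le> y\<^sup>2 + z" "0 \<le> y" "0 \<le> z"
  shows "x \<le> y + sqrt z"
proof (rule power2_le_imp_le)
  have "(y + sqrt z)\<^sup>2 = y\<^sup>2 + z + 2 * y * sqrt z" using assms by (simp add: power2_sum)
  moreover have "0 \<le> 2 * y * sqrt z" using assms by simp
  ultimately show "x\<^sup>2 \<le> (y + sqrt z)\<^sup>2" using assms(1) by linarith
qed (use assms in simp)

lemma potential_comparison:
  fixes k :: "real \<Rightarrow> real"
  assumes N: "N \<ge> 1" and a: "a > 0"
    and k: "continuous_on {0..} k" "\<And>t. t > 0 \<Longrightarrow> 0 < k t"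
    and g: "continuous_on {0..} g" "\<And>t. t \<ge> 0 \<Longrightarrow> 0 \<le> g t"
    and Q: "continuous_on {R..r} Q" "\<And>x. x \<in> {R<..<r} \<Longrightarrow> (Q has_real_derivative q x) (at x)"
    and le: "\<And>x. x \<in> {R<..<r} \<Longrightarrow>
      flux N g x \<le> q x * sqrt (integral {0..a + potential N g x} k)"
    and R: "0 \<le> R" "R \<le> r"
  shows "integral {a..a + potential N g r} (\<lambda>s. 1 / sqrt (integral {0..s} k)) - Q r
    \<le> integral {a..a + potential N g R} (\<lambda>s. 1 / sqrt (integral {0..s} k)) - Q R"
proof (rule integral_inverse_sqrt_comparison[where v = "flux N g" and q = q])
  show "continuous_on {a..} (\<lambda>s. integral {0..s} k)"
    by (rule continuous_on_subset[OF primitive_continuous_on[OF k(1)]]) (use a in auto)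
  show "0 < integral {0..s} k" if "s \<ge> a" for s
    using a that by (intro primitive_pos[OF k]) auto
  show "continuous_on {R..r} (\<lambda>r. a + potential N g r)"
    by (intro continuous_intros continuous_on_subset[OF potential_continuous_on[OF N g(1)]])
      (use R in auto)
  show "a \<le> a + potential N g x" for x
    using potential_nonneg[of g N x] g(2) by simp
  show "((\<lambda>r. a + potential N g r) has_real_derivative flux N g x) (at x)" if "x \<in> {R<..<r}" for x
    using that R DERIV_add[OF DERIV_const
        has_derivative_at_of_halfline[OF potential_has_derivative[OF N g(1)]]]
    by simp
qed (use Q le R in auto)

text \<open>By the energy bound, \<open>H\<close> along \<open>a + potential N g\<close> grows at
  most like \<open>sqrt (2 * A) * r\<close>. The order of the quantifiers matters: \<open>B\<close>
  is chosen before \<open>g\<close>, so that one bound serves all iterates.\<close>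

lemma potential_locally_bounded:
  fixes k :: "real \<Rightarrow> real"
  assumes N: "N \<ge> 1" and a: "a > 0"
    and k: "continuous_on {0..} k" "\<And>t. t \<ge> 0 \<Longrightarrow> 0 \<le> k t" "\<And>t. t > 0 \<Longrightarrow> 0 < k t"
    and inf: "has_infinite_limit (\<lambda>r. integral {a..r} (\<lambda>s. 1 / sqrt (integral {0..s} k)))"
    and A: "0 \<le> A"
  shows "\<exists>B. \<forall>g. continuous_on {0..} g \<longrightarrow> (\<forall>t\<ge>0. 0 \<le> g t) \<longrightarrow>
    (\<forall>t\<in>{0..R}. g t \<le> A * k (a + potential N g t)) \<longrightarrow> (\<forall>r\<in>{0..R}. a + potential N g r \<le> B)"
proof -
  define H where "H r = integral {a..r} (\<lambda>s. 1 / sqrt (integral {0..s} k))" for r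
  obtain B where B: "\<And>s. H s \<le> sqrt (2 * A) * R \<Longrightarrow> s \<le> B"
    using has_infinite_limit_bound[of H] inf unfolding H_def by blast
  have "a + potential N g r \<le> B"
    if g: "continuous_on {0..} g" "\<forall>t\<ge>0. 0 \<le> g t" and
      le: "\<forall>t\<in>{0..R}. g t \<le> A * k (a + potential N g t)" and r: "r \<in> {0..R}" for g r
  proof -
    have g0: "\<And>t. t \<ge> 0 \<Longrightarrow> 0 \<le> g t" using g(2) by simp
    have "H (a + potential N g r) - sqrt (2 * A) * r \<le> H (a + potential N g 0) - sqrt (2 * A) * 0"
      unfolding H_def
    proof (rule potential_comparison[OF N a k(1,3) g(1) g0])
      fix x assume x: "x \<in> {0<..<r}"
      have "(flux N g x)\<^sup>2 \<le> 2 * A * integral {0..a + potential N g x} k"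
        using x r le by (intro flux_energy_bound N g g0 a k A) auto
      then show "flux N g x \<le> sqrt (2 * A) * sqrt (integral {0..a + potential N g x} k)"
        by (simp add: real_le_rsqrt flip: real_sqrt_mult)
    next
      show "((*) (sqrt (2 * A)) has_real_derivative sqrt (2 * A)) (at x)" for x
        by (auto intro!: derivative_eq_intros)
    qed (use r in \<open>auto intro!: continuous_intros\<close>)
    moreover have "sqrt (2 * A) * r \<le> sqrt (2 * A) * R"
      using r A by (intro mult_left_mono) auto
    ultimately show ?thesis
      by (intro B) (simp add: H_def)
  qed
  then show ?thesis by blast
qed

text \<open>Beyond \<open>R\<close> the weighted energy bound gives
  \<open>u' \<le> q * sqrt (K u)\<close>, where the primitive \<open>Q\<close> of \<open>q\<close>
  is bounded above. Hence \<open>H u\<close> is bounded on the half-line, and so is \<open>u\<close>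
  because \<open>H\<close> diverges.\<close>

lemma potential_globally_bounded:
  fixes k \<rho> :: "real \<Rightarrow> real"
  assumes N: "N \<ge> 3" and a: "a > 0"
    and k: "continuous_on {0..} k" "\<And>t. t \<ge> 0 \<Longrightarrow> 0 \<le> k t" "\<And>t. t > 0 \<Longrightarrow> 0 < k t"
    and inf: "has_infinite_limit (\<lambda>r. integral {a..r} (\<lambda>s. 1 / sqrt (integral {0..s} k)))"
    and c: "0 \<le> c"
    and g: "continuous_on {0..} g" "\<And>t. t \<ge> 0 \<Longrightarrow> 0 \<le> g t"
    and \<rho>: "continuous_on {0..} \<rho>" "\<And>t. t \<ge> 0 \<Longrightarrow> 0 \<le> \<rho> t"
    and le: "\<And>t. t \<ge> 0 \<Longrightarrow> g t \<le> c * \<rho> t * k (a + potential N g t)"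
    and mono: "mono_on {R0..} (\<lambda>r. r ^ (2 * N - 2) * \<rho> r)"
    and \<epsilon>: "\<epsilon> > 0"
    and Z: "\<And>r. r \<ge> 0 \<Longrightarrow> integral {0..r} (\<lambda>z. z powr (1 + \<epsilon>) * \<rho> z) \<le> B0"
  shows "\<exists>B. \<forall>r\<ge>0. a + potential N g r \<le> B"
proof -
  have N1: "N \<ge> 1" using N by simp
  define H where "H r = integral {a..r} (\<lambda>s. 1 / sqrt (integral {0..s} k))" for r
  define Z where "Z r = integral {0..r} (\<lambda>z. z powr (1 + \<epsilon>) * \<rho> z)" for r
  \<comment> \<open>The bound \<open>R \<ge> 1\<close> later gives
    \<open>x\<^sup>2 \<le> x ^ (N - 1)\<close>.\<close>
  define R where "R = max R0 1"
  have R: "R \<ge> R0" "R \<ge> 1" by (auto simp: R_def)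
  define C where "C = R ^ (N - 1) * flux N g R"
  have "0 \<le> flux N g R"
    by (rule flux_nonneg) (use R g(2) in auto)
  then have C: "C \<ge> 0" using R by (simp add: C_def)
  define K where "K s = integral {0..s} k" for s
  have K: "K s > 0" if "s > 0" for s using primitive_pos[OF k(1,3) that] by (simp add: K_def)
  \<comment> \<open>As \<open>K u \<ge> K a\<close>, this choice bounds the constant
    \<open>C\<close> by \<open>D * sqrt (K u)\<close>.\<close>
  define D where "D = C / sqrt (K a)"
  \<comment> \<open>The halving anticipates the factor \<open>2\<close> from the inequality of
    arithmetic and geometric means.\<close>
  define E where "E = sqrt (2 * c) / 2"
  have D: "D \<ge> 0" and E: "E \<ge> 0" using C c K[OF a] by (auto simp: D_def E_def)
  \<comment> \<open>An explicit primitive of \<open>q\<close>. The terms other than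
    \<open>E * Z r\<close> are nonpositive for positive \<open>r\<close>, so an upper bound on
    \<open>Z\<close> bounds \<open>Q\<close>.\<close>
  define Q where "Q r = - D / r + E * (Z r - r powr (- \<epsilon>) / \<epsilon>)" for r
  define q where "q r = D / r\<^sup>2 + E * (r powr (1 + \<epsilon>) * \<rho> r + r powr (- \<epsilon> - 1))" for r
  have contZ: "continuous_on {0..} (\<lambda>z. z powr (1 + \<epsilon>) * \<rho> z)"
    using \<epsilon> by (intro continuous_intros continuous_on_powr' \<rho>) auto
  have dQ: "(Q has_real_derivative q x) (at x)" if "x > 0" for x
  proof -
    have "(Z has_real_derivative x powr (1 + \<epsilon>) * \<rho> x) (at x)"
      using has_derivative_at_of_halfline[OF integral_has_derivative_halfline[OF contZ]] that
      by (simp add: Z_def[abs_def])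
    then have "(Q has_real_derivative - D * (- inverse (x ^ Suc (Suc 0)))
        + E * (x powr (1 + \<epsilon>) * \<rho> x - (- \<epsilon> * x powr (- \<epsilon> - 1)) / \<epsilon>)) (at x)"
      unfolding Q_def using that \<epsilon>
      by (auto intro!: derivative_eq_intros simp: field_simps power2_eq_square)
    then show ?thesis
      using \<epsilon> that by (simp add: q_def field_simps power2_eq_square)
  qed
  have flux_le: "flux N g x \<le> q x * sqrt (K (a + potential N g x))" if x: "x \<ge> R" for x
  proof -
    let ?K = "K (a + potential N g x)"
    have "x \<ge> 1" using x R by simp
    have Ka: "K a \<le> ?K"
      using potential_nonneg[of g N x] g(2) unfolding K_def by (intro primitive_mono[OF k(1,2)]) auto
    have "(x ^ (N - 1) * flux N g x)\<^sup>2 \<le> C\<^sup>2 + 2 * (c * (x ^ (2 * N - 2) * \<rho> x)) * ?K"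
      unfolding C_def K_def
    proof (rule flux_weighted_energy_bound[where m = "\<lambda>x. c * (x ^ (2 * N - 2) * \<rho> x)"])
      show "mono_on {R..} (\<lambda>x. c * (x ^ (2 * N - 2) * \<rho> x))"
        using mono R c by (auto simp: mono_on_def intro!: mult_left_mono)
      show "t ^ (2 * N - 2) * g t \<le> c * (t ^ (2 * N - 2) * \<rho> t) * k (a + potential N g t)"
        if "R \<le> t" for t
        using mult_left_mono[OF le[of t], of "t ^ (2 * N - 2)"] that R by (simp add: mult_ac)
    qed (use N1 g a k R c \<rho> x in auto)
    then have "x ^ (N - 1) * flux N g x \<le> C + sqrt (2 * (c * (x ^ (2 * N - 2) * \<rho> x)) * ?K)"
      using C c \<rho> K[OF a] Ka \<open>x \<ge> 1\<close> by (intro real_le_sqrt_add) auto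
    also have "sqrt (2 * (c * (x ^ (2 * N - 2) * \<rho> x)) * ?K) = x ^ (N - 1) * (2 * E * sqrt (\<rho> x) * sqrt ?K)"
    proof -
      have "2 * N - 2 = (N - 1) * 2" by simp
      then have "x ^ (2 * N - 2) = (x ^ (N - 1))\<^sup>2"
        by (simp only: power_mult)
      then show ?thesis
        using \<open>x \<ge> 1\<close> by (simp add: E_def real_sqrt_mult)
    qed
    also have "C \<le> D * sqrt ?K"
      using C Ka K[OF a] by (auto simp: D_def field_simps intro!: mult_left_mono)
    \<comment> \<open>This is where \<open>N \<ge> 3\<close> enters: after division by
      \<open>x ^ (N - 1)\<close> the constant contributes at most the integrable term
      \<open>D / x\<^sup>2\<close>.\<close>
    also have "D * sqrt ?K \<le> x ^ (N - 1) * (D / x\<^sup>2 * sqrt ?K)"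
    proof -
      have "x\<^sup>2 \<le> x ^ (N - 1)" using N \<open>x \<ge> 1\<close> by (intro power_increasing) auto
      then have "1 \<le> x ^ (N - 1) / x\<^sup>2" using \<open>x \<ge> 1\<close> by (simp add: field_simps)
      then have "1 * (D * sqrt ?K) \<le> x ^ (N - 1) / x\<^sup>2 * (D * sqrt ?K)"
        using D K[OF a] Ka by (intro mult_right_mono) auto
      then show ?thesis by simp
    qed
    finally have "x ^ (N - 1) * flux N g x \<le> x ^ (N - 1) * (D / x\<^sup>2 * sqrt ?K + 2 * E * sqrt (\<rho> x) * sqrt ?K)"
      by (simp add: distrib_left)
    then have "flux N g x \<le> D / x\<^sup>2 * sqrt ?K + 2 * E * sqrt (\<rho> x) * sqrt ?K"
      by (rule mult_left_le_imp_le) (use \<open>x \<ge> 1\<close> in simp)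
    also have "\<dots> = (D / x\<^sup>2 + E * (2 * sqrt (\<rho> x))) * sqrt ?K"
      by (simp add: distrib_right)
    \<comment> \<open>The two terms multiply to \<open>\<rho> x\<close>. The powers are split so
      that the first term is the integrand of \<open>Z\<close> and the second is integrable at
      infinity because \<open>\<epsilon> > 0\<close>.\<close>
    also have "2 * sqrt (\<rho> x) \<le> x powr (1 + \<epsilon>) * \<rho> x + x powr (- \<epsilon> - 1)"
    proof -
      have eq: "(x powr (1 + \<epsilon>) * \<rho> x) * x powr (- \<epsilon> - 1) = \<rho> x"
        using \<open>x \<ge> 1\<close> by (simp flip: powr_add)
      have "sqrt ((x powr (1 + \<epsilon>) * \<rho> x) * x powr (- \<epsilon> - 1))
          \<le> (x powr (1 + \<epsilon>) * \<rho> x + x powr (- \<epsilon> - 1)) / 2"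
        using \<open>x \<ge> 1\<close> \<rho>(2)[of x] by (intro arith_geo_mean_sqrt) auto
      then show ?thesis unfolding eq by (simp add: mult.commute[of 2])
    qed
    finally show ?thesis
      using E K[OF a] Ka by (simp add: q_def mult_left_mono mult_right_mono)
  qed
  have H_le: "H (a + potential N g r) \<le> H (a + potential N g R) + E * B0 - Q R" if "r \<ge> R" for r
  proof -
    have "H (a + potential N g r) - Q r \<le> H (a + potential N g R) - Q R"
      unfolding H_def
    proof (rule potential_comparison[OF N1 a k(1,3) g])
      show "continuous_on {R..r} Q"
        using R by (intro DERIV_continuous_on[OF has_field_derivative_at_within[OF dQ]]) auto
      show "flux N g x \<le> q x * sqrt (integral {0..a + potential N g x} k)" if "x \<in> {R<..<r}" for x
        using flux_le[of x] that by (simp add: K_def)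
    qed (use R that dQ in auto)
    moreover have "Q r \<le> E * B0"
    proof -
      have "Z r \<le> B0" using Z[of r] R that by (simp add: Z_def)
      moreover have "0 \<le> r powr (- \<epsilon>) / \<epsilon>" using \<epsilon> by simp
      ultimately have "Z r - r powr (- \<epsilon>) / \<epsilon> \<le> B0" by linarith
      then have "E * (Z r - r powr (- \<epsilon>) / \<epsilon>) \<le> E * B0" using E by (rule mult_left_mono)
      moreover have "- D / r \<le> 0" using D R that by simp
      ultimately show ?thesis
        using add_mono[of "- D / r" 0] by (simp add: Q_def)
    qed
    ultimately show ?thesis by simp
  qed
  obtain B where B: "\<And>s. H s \<le> H (a + potential N g R) + E * B0 - Q R \<Longrightarrow> s \<le> B"
    using has_infinite_limit_bound[of H] inf unfolding H_def by blast
  have "a + potential N g r \<le> B" if "r \<ge> 0" for r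
  proof -
    have "potential N g r \<le> potential N g (max r R)"
      using that by (intro potential_mono_arg N1 g) auto
    moreover have "a + potential N g (max r R) \<le> B"
      by (intro B H_le) auto
    ultimately show ?thesis by simp
  qed
  then show ?thesis by blast
qed

section \<open>Limits of potentials\<close>

lemma continuous_on_halflineI:
  fixes f :: "real \<Rightarrow> real"
  assumes "\<And>R. continuous_on {0..R} f"
  shows "continuous_on {0..} f"
  unfolding continuous_on_eq_continuous_within
proof
  fix r :: real assume "r \<in> {0..}"
  then have "continuous (at r within {0..r+1}) f"
    using assms[of "r + 1"] by (simp add: continuous_on_eq_continuous_within)
  moreover have "at r within {0..r+1} = at r within {0..}"
    by (rule at_within_nhd[of _ "{..<r+1}"]) auto
  ultimately show "continuous (at r within {0..}) f"
    by (simp add: continuous_within)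
qed

lemma continuous_on_bounded_above:
  fixes f :: "real \<Rightarrow> real"
  assumes "continuous_on {0..} f"
  shows "\<exists>B\<ge>0. \<forall>t\<in>{0..R}. f t \<le> B"
proof -
  have "bounded (f ` {0..R})"
    by (intro compact_imp_bounded compact_continuous_image continuous_on_subset[OF assms]) auto
  then obtain B where "\<forall>t\<in>{0..R}. norm (f t) \<le> B"
    unfolding bounded_iff by auto
  then show ?thesis
    by (intro exI[of _ "\<bar>B\<bar>"]) (force simp: abs_le_iff)
qed

text \<open>Dominated convergence is used twice, for the moment integral and then for the flux. As
  \<open>G\<close> is only a pointwise limit, integrability of its flux comes from the second use
  and in turn gives continuity of its potential.\<close>

lemma potential_dominated_convergence:
  assumes "N \<ge> 1" and g: "\<And>k. continuous_on {0..} (g k)"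
    and B: "\<And>k t. t \<in> {0..R} \<Longrightarrow> \<bar>g k t\<bar> \<le> B"
    and G: "\<And>t. t \<in> {0..R} \<Longrightarrow> (\<lambda>k. g k t) \<longlonglongrightarrow> G t"
  shows "continuous_on {0..R} (potential N G)"
    and "r \<in> {0..R} \<Longrightarrow> (\<lambda>k. potential N (g k) r) \<longlonglongrightarrow> potential N G r"
proof -
  have flux: "(\<lambda>k. flux N (g k) y) \<longlonglongrightarrow> flux N G y" if y: "y \<in> {0..R}" for y
    unfolding flux_def
  proof (rule tendsto_mult_left, rule dominated_convergence(2)[where h = "\<lambda>_. R ^ (N - 1) * B"])
    show "(\<lambda>t. t ^ (N - 1) * g k t) integrable_on {0..y}" for k
      by (rule integrable_on_moment[OF g])
    show "norm (t ^ (N - 1) * g k t) \<le> R ^ (N - 1) * B" if "t \<in> {0..y}" for k t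
      using that y B[of t k] by (auto simp: abs_mult intro!: mult_mono power_mono)
    show "(\<lambda>k. t ^ (N - 1) * g k t) \<longlonglongrightarrow> t ^ (N - 1) * G t" if "t \<in> {0..y}" for t
      using that y by (intro tendsto_mult_left G) auto
  qed auto
  have int: "flux N G integrable_on {0..r}"
    and lim: "(\<lambda>k. integral {0..r} (flux N (g k))) \<longlonglongrightarrow> integral {0..r} (flux N G)"
    if r: "r \<in> {0..R}" for r
  proof -
    have 1: "flux N (g k) integrable_on {0..r}" for k
      by (rule flux_integrable_on[OF assms(1) g])
    have 2: "norm (flux N (g k) y) \<le> B * R" if "y \<in> {0..r}" for k y
    proof -
      have "\<bar>flux N (g k) y\<bar> \<le> B * y"
        using that r B by (intro flux_abs_le assms(1) g) auto
      also have "B * y \<le> B * R"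
        using that r B[of 0 k] by (intro mult_left_mono) auto
      finally show ?thesis by simp
    qed
    have 3: "(\<lambda>k. flux N (g k) y) \<longlonglongrightarrow> flux N G y" if "y \<in> {0..r}" for y
      using that r by (intro flux) auto
    show "flux N G integrable_on {0..r}"
      by (rule dominated_convergence(1)[where h = "\<lambda>_. B * R", OF 1 _ 2 3]) auto
    show "(\<lambda>k. integral {0..r} (flux N (g k))) \<longlonglongrightarrow> integral {0..r} (flux N G)"
      by (rule dominated_convergence(2)[where h = "\<lambda>_. B * R", OF 1 _ 2 3]) auto
  qed
  show "continuous_on {0..R} (potential N G)"
  proof (cases "R \<ge> 0")
    case True
    then show ?thesis
      unfolding potential_def[abs_def]
      by (intro indefinite_integral_continuous_1 int) auto
  qed auto
  show "r \<in> {0..R} \<Longrightarrow> (\<lambda>k. potential N (g k) r) \<longlonglongrightarrow> potential N G r"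
    unfolding potential_def by (rule lim)
qed

lemma continuous_on_weighted_comp:
  fixes p f x :: "real \<Rightarrow> real"
  assumes "continuous_on {0..} p" "continuous_on {0..} f" "continuous_on {0..} x"
    and "\<And>t. t \<ge> 0 \<Longrightarrow> 0 \<le> x t"
  shows "continuous_on {0..} (\<lambda>t. p t * f (x t))"
  by (intro continuous_on_mult assms(1) continuous_on_compose2[OF assms(2,3)]) (use assms(4) in auto)

text \<open>Monotonicity of \<open>f\<close> turns a common bound on the \<open>X k\<close> into the
  required domination. \<open>L\<close> is a mere pointwise limit here; in the existence proof its
  continuity is deduced from the first conclusion.\<close>

lemma potential_weighted_comp_limit:
  fixes p f L :: "real \<Rightarrow> real" and X :: "nat \<Rightarrow> real \<Rightarrow> real"
  assumes N: "N \<ge> 1"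
    and p: "continuous_on {0..} p" "\<And>t. t \<ge> 0 \<Longrightarrow> 0 \<le> p t"
    and f: "continuous_on {0..} f" "mono_on {0..} f" "\<And>t. t \<ge> 0 \<Longrightarrow> 0 \<le> f t"
    and X: "\<And>k. continuous_on {0..} (X k)" "\<And>k t. t \<ge> 0 \<Longrightarrow> 0 \<le> X k t"
    and bdd: "\<And>R. \<exists>B. \<forall>k. \<forall>t\<in>{0..R}. X k t \<le> B"
    and L: "\<And>t. t \<ge> 0 \<Longrightarrow> (\<lambda>k. X k t) \<longlonglongrightarrow> L t"
  shows "continuous_on {0..} (potential N (\<lambda>t. p t * f (L t)))"
    and "r \<ge> 0 \<Longrightarrow> (\<lambda>k. potential N (\<lambda>t. p t * f (X k t)) r) \<longlonglongrightarrow> potential N (\<lambda>t. p t * f (L t)) r"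
proof -
  have cont: "continuous_on {0..} (\<lambda>t. p t * f (X k t))" for k
    by (rule continuous_on_weighted_comp[OF p(1) f(1) X(1)]) (rule X(2))
  have lim: "(\<lambda>k. p t * f (X k t)) \<longlonglongrightarrow> p t * f (L t)" if t: "t \<ge> 0" for t
  proof (intro tendsto_mult_left continuous_on_tendsto_compose[OF f(1) L[OF t]])
    show "L t \<in> {0..}"
      using LIMSEQ_le_const[OF L[OF t]] X(2)[OF t] by auto
    show "\<forall>\<^sub>F k in sequentially. X k t \<in> {0..}"
      using X(2)[OF t] by simp
  qed
  have bound: "\<exists>B. \<forall>k. \<forall>t\<in>{0..R}. \<bar>p t * f (X k t)\<bar> \<le> B" for R
  proof -
    obtain B where B: "\<And>k t. t \<in> {0..R} \<Longrightarrow> X k t \<le> B" using bdd by blast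
    obtain P where P: "P \<ge> 0" "\<And>t. t \<in> {0..R} \<Longrightarrow> p t \<le> P"
      using continuous_on_bounded_above[OF p(1)] by blast
    have "\<bar>p t * f (X k t)\<bar> \<le> P * f B" if t: "t \<in> {0..R}" for k t
    proof -
      have "0 \<le> X k t" "X k t \<le> B" using t X(2) B by auto
      then have "f (X k t) \<le> f B" by (intro mono_onD[OF f(2)]) auto
      moreover have "0 \<le> p t" "0 \<le> f (X k t)" using t p(2) f(3) X(2) by auto
      ultimately show ?thesis
        using P t by (simp add: abs_mult mult_mono)
    qed
    then show ?thesis by blast
  qed
  have *: "continuous_on {0..R} (potential N (\<lambda>t. p t * f (L t)))"
    "r \<in> {0..R} \<Longrightarrow> (\<lambda>k. potential N (\<lambda>t. p t * f (X k t)) r) \<longlonglongrightarrow> potential N (\<lambda>t. p t * f (L t)) r"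
    for R r
  proof -
    obtain B where B: "\<And>k t. t \<in> {0..R} \<Longrightarrow> \<bar>p t * f (X k t)\<bar> \<le> B" using bound by blast
    show "continuous_on {0..R} (potential N (\<lambda>t. p t * f (L t)))"
      by (rule potential_dominated_convergence(1)[OF N cont B lim]) auto
    show "r \<in> {0..R} \<Longrightarrow> (\<lambda>k. potential N (\<lambda>t. p t * f (X k t)) r) \<longlonglongrightarrow> potential N (\<lambda>t. p t * f (L t)) r"
      by (rule potential_dominated_convergence(2)[OF N cont B lim]) auto
  qed
  show "continuous_on {0..} (potential N (\<lambda>t. p t * f (L t)))"
    by (rule continuous_on_halflineI) (rule *(1))
  show "r \<ge> 0 \<Longrightarrow> (\<lambda>k. potential N (\<lambda>t. p t * f (X k t)) r) \<longlonglongrightarrow> potential N (\<lambda>t. p t * f (L t)) r"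
    by (rule *(2)[of r r]) simp
qed

text \<open>The dichotomy allows boundedness to be assumed as negated divergence, which suits the
  finiteness claims and, by contraposition, the necessary condition for large solutions.\<close>

lemma mono_has_infinite_limit_or_bounded:
  assumes "mono_on {0..} F"
  shows "has_infinite_limit F \<or> (\<exists>B. \<forall>r\<ge>0. F r \<le> B)"
proof (rule disjCI)
  assume "\<not> (\<exists>B. \<forall>r\<ge>0. F r \<le> B)"
  then have "\<exists>R\<ge>0. C < F R" for C by (meson not_le)
  then have "\<exists>R. \<forall>r\<ge>R. C \<le> F r" for C
    using mono_onD[OF assms] by (meson atLeast_iff less_imp_le order_trans)
  then show "has_infinite_limit F"
    unfolding has_infinite_limit_def filterlim_at_top eventually_at_top_linorder by blast
qed

lemma mono_bounded_has_finite_limit: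
  assumes "mono_on {0..} F" "\<And>r. r \<ge> 0 \<Longrightarrow> F r \<le> B"
  shows "has_finite_limit F"
proof -
  have bdd: "bdd_above (F ` {0..})" using assms(2) by (auto intro!: bdd_aboveI)
  have "(F \<longlongrightarrow> (SUP r\<in>{0..}. F r)) at_top"
  proof (rule increasing_tendsto)
    show "\<forall>\<^sub>F r in at_top. F r \<le> (SUP r\<in>{0..}. F r)"
      using eventually_ge_at_top[of 0] by eventually_elim (auto intro: cSUP_upper bdd)
    fix x assume "x < (SUP r\<in>{0..}. F r)"
    then obtain R where R: "R \<ge> 0" "x < F R"
      using less_cSUP_iff[OF _ bdd] by auto
    have "x < F r" if "R \<le> r" for r
      using R mono_onD[OF assms(1), of R r] that by simp
    then show "\<forall>\<^sub>F r in at_top. x < F r"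
      unfolding eventually_at_top_linorder by blast
  qed
  then show ?thesis unfolding has_finite_limit_def by blast
qed

lemma not_has_finite_and_infinite_limit:
  assumes "has_finite_limit F" "has_infinite_limit F"
  shows False
  using assms filterlim_at_top_imp_at_infinity
    not_tendsto_and_filterlim_at_infinity[of "at_top :: real filter" F]
  unfolding has_finite_limit_def has_infinite_limit_def by auto

lemma P1_eq_potential:
  "P1 N p1 p2 f1 f2 a b r = potential N (\<lambda>t. p1 t * f1 (b + f2 a * potential N p2 t)) r"
  unfolding P1_def G1_def potential_def flux_def[abs_def] by (simp only: mult.assoc)

lemma P2_eq_potential:
  "P2 N p1 p2 \<omega> \<epsilon> r =
    integral {0..r} (\<lambda>z. z powr (1 + \<epsilon>) * (p1 z * \<omega> (1 + potential N p2 z)))"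
  unfolding P2_def potential_def flux_def[abs_def] by (simp only: mult.assoc)

section \<open>Bounds for one component\<close>

text \<open>The hypotheses that control the first component; exchanging the roles of the two
  components turns \<open>Q1, Q2, H2, M2\<close> into \<open>P1, P2, H1, M1\<close>.\<close>

locale controlled_component =
  fixes N :: nat and a b c :: real and p1 p2 f1 f2 h \<omega> :: "real \<Rightarrow> real"
  assumes N: "N \<ge> 3" and ab: "a > 0" "b > 0" and c: "c > 0"
    and p_cont: "continuous_on {0..} p1" "continuous_on {0..} p2"
    and p_nonneg: "\<And>r. r \<ge> 0 \<Longrightarrow> 0 \<le> p1 r" "\<And>r. r \<ge> 0 \<Longrightarrow> 0 \<le> p2 r"
    and f_cont: "continuous_on {0..} f1" "continuous_on {0..} f2"
    and f_mono: "mono_on {0..} f1" "mono_on {0..} f2"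
    and f_zero: "f1 0 = 0" "f2 0 = 0"
    and f2_pos: "\<And>s. s > 0 \<Longrightarrow> 0 < f2 s"
    and h_cont: "continuous_on {0..} h" and \<omega>_cont: "continuous_on {0..} \<omega>"
    and h_incr: "strict_mono_on {0..} h" and \<omega>_incr: "strict_mono_on {0..} \<omega>"
    and h_nonneg: "\<And>t. t \<ge> 0 \<Longrightarrow> 0 \<le> h t" and \<omega>_nonneg: "\<And>t. t \<ge> 0 \<Longrightarrow> 0 \<le> \<omega> t"
    and growth: "\<And>t w. w \<ge> 1 \<Longrightarrow> t \<ge> M1 f2 a b * f2 a \<Longrightarrow> f1 (t * w) \<le> c * h t * \<omega> w"
    and H1_inf: "has_infinite_limit (H1 h f2 a b)"
begin

definition k :: "real \<Rightarrow> real" where "k t = h (M1 f2 a b * f2 t)"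

text \<open>The effective weight of the decoupled inequality; \<open>P2\<close> integrates it
  against \<open>z powr (1 + \<epsilon>)\<close>.\<close>

definition \<rho> :: "real \<Rightarrow> real" where "\<rho> t = p1 t * \<omega> (1 + potential N p2 t)"

lemma N1: "N \<ge> 1" using N by simp

lemma f_nonneg: "t \<ge> 0 \<Longrightarrow> 0 \<le> f1 t" "t \<ge> 0 \<Longrightarrow> 0 \<le> f2 t"
  using mono_onD[OF f_mono(1), of 0 t] mono_onD[OF f_mono(2), of 0 t] f_zero by auto

text \<open>The case distinction in \<open>M1\<close> makes \<open>M1 f2 a b * f2 a\<close> the
  maximum of \<open>b\<close> and \<open>f2 a\<close>.\<close>

lemma M1_ge: "M1 f2 a b \<ge> 1" "M1 f2 a b * f2 a \<ge> b"
  using f2_pos[OF ab(1)] by (auto simp: M1_def)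

lemma M1_f2_nonneg: "t \<ge> 0 \<Longrightarrow> 0 \<le> M1 f2 a b * f2 t"
  using M1_ge(1) by (intro mult_nonneg_nonneg f_nonneg(2)) simp_all

lemma k_cont: "continuous_on {0..} k"
  unfolding k_def
proof (rule continuous_on_compose2[OF h_cont])
  show "continuous_on {0..} (\<lambda>t. M1 f2 a b * f2 t)"
    by (intro continuous_intros f_cont)
  show "(\<lambda>t. M1 f2 a b * f2 t) ` {0..} \<subseteq> {0..}"
    by (auto intro: M1_f2_nonneg)
qed

lemma k_nonneg: "t \<ge> 0 \<Longrightarrow> 0 \<le> k t"
  unfolding k_def by (intro h_nonneg M1_f2_nonneg)

lemma k_pos:
  assumes "t > 0"
  shows "0 < k t"
proof -
  have "0 < M1 f2 a b * f2 t" using M1_ge(1) f2_pos[OF assms] by simp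
  then have "h 0 < k t"
    unfolding k_def by (intro strict_mono_onD[OF h_incr]) auto
  then show ?thesis using h_nonneg[of 0] by simp
qed

lemma k_inf: "has_infinite_limit (\<lambda>r. integral {a..r} (\<lambda>s. 1 / sqrt (integral {0..s} k)))"
  using H1_inf by (simp add: H1_def[abs_def] k_def[abs_def])

lemma potential_p2_nonneg: "0 \<le> potential N p2 t"
  by (rule potential_nonneg) (rule p_nonneg)

lemma \<rho>_cont: "continuous_on {0..} \<rho>"
  unfolding \<rho>_def
proof (rule continuous_on_weighted_comp[OF p_cont(1) \<omega>_cont])
  show "continuous_on {0..} (\<lambda>t. 1 + potential N p2 t)"
    by (intro continuous_intros potential_continuous_on N1 p_cont)
  show "0 \<le> 1 + potential N p2 t" for t
    using potential_p2_nonneg[of t] by simp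
qed

lemma \<omega>_potential_nonneg: "0 \<le> \<omega> (1 + potential N p2 t)"
  using potential_p2_nonneg[of t] by (intro \<omega>_nonneg) simp

lemma \<rho>_nonneg: "t \<ge> 0 \<Longrightarrow> 0 \<le> \<rho> t"
  unfolding \<rho>_def by (intro mult_nonneg_nonneg p_nonneg \<omega>_potential_nonneg)

text \<open>Since \<open>x\<close> and \<open>f2\<close> are nondecreasing, \<open>f2 (x r)\<close>
  bounds its earlier values and can be pulled out of the potential; also
  \<open>b \<le> M1 f2 a b * f2 (x r)\<close>. So \<open>y\<close> is at most a product to which
  \<open>growth\<close> applies. Asking only for an inequality on \<open>y\<close> covers iterates
  as well as solutions.\<close>

lemma source_le:
  assumes x: "continuous_on {0..} x" "\<And>t. t \<ge> 0 \<Longrightarrow> a \<le> x t" "mono_on {0..} x"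
    and y: "0 \<le> y" "y \<le> b + potential N (\<lambda>t. p2 t * f2 (x t)) r" and r: "r \<ge> 0"
  shows "p1 r * f1 y \<le> c * \<rho> r * k (x r)"
proof -
  have x_nonneg: "0 \<le> x t" if "t \<ge> 0" for t using x(2)[OF that] ab by simp
  have "potential N (\<lambda>t. p2 t * f2 (x t)) r \<le> potential N (\<lambda>t. f2 (x r) * p2 t) r"
  proof (rule potential_mono[OF N1])
    show "continuous_on {0..} (\<lambda>t. p2 t * f2 (x t))"
      by (rule continuous_on_weighted_comp[OF p_cont(2) f_cont(2) x(1)]) (rule x_nonneg)
    show "continuous_on {0..} (\<lambda>t. f2 (x r) * p2 t)"
      by (intro continuous_intros p_cont)
    fix t assume t: "0 \<le> t" "t \<le> r"
    then have "x t \<le> x r" by (intro mono_onD[OF x(3)]) auto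
    then have "f2 (x t) \<le> f2 (x r)" using x_nonneg t r by (intro mono_onD[OF f_mono(2)]) auto
    then show "p2 t * f2 (x t) \<le> f2 (x r) * p2 t"
      using p_nonneg(2)[OF t(1)] by (simp add: mult.commute mult_left_mono)
  qed
  then have "y \<le> b + f2 (x r) * potential N p2 r"
    using y(2) by (simp add: potential_cmult)
  also have "b \<le> M1 f2 a b * f2 (x r)"
  proof -
    have "f2 a \<le> f2 (x r)" using x(2)[OF r] ab by (intro mono_onD[OF f_mono(2)]) auto
    then have "M1 f2 a b * f2 a \<le> M1 f2 a b * f2 (x r)" using M1_ge(1) by simp
    with M1_ge(2) show ?thesis by simp
  qed
  also have "f2 (x r) * potential N p2 r \<le> M1 f2 a b * f2 (x r) * potential N p2 r"
    using M1_ge(1) f_nonneg(2)[OF x_nonneg[OF r]] potential_p2_nonneg[of r]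
      mult_right_mono[of 1 "M1 f2 a b" "f2 (x r)"] by (intro mult_right_mono) auto
  finally have "y \<le> M1 f2 a b * f2 (x r) * (1 + potential N p2 r)"
    by (simp add: distrib_left)
  then have "f1 y \<le> f1 (M1 f2 a b * f2 (x r) * (1 + potential N p2 r))"
    using y(1) by (intro mono_onD[OF f_mono(1)]) auto
  also have "\<dots> \<le> c * k (x r) * \<omega> (1 + potential N p2 r)"
    unfolding k_def
  proof (rule growth)
    have "f2 a \<le> f2 (x r)" using x(2)[OF r] ab by (intro mono_onD[OF f_mono(2)]) auto
    then show "M1 f2 a b * f2 a \<le> M1 f2 a b * f2 (x r)" using M1_ge(1) by simp
  qed (use potential_p2_nonneg[of r] in simp)
  finally have "p1 r * f1 y \<le> p1 r * (c * k (x r) * \<omega> (1 + potential N p2 r))"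
    by (rule mult_left_mono) (rule p_nonneg(1)[OF r])
  then show ?thesis by (simp add: \<rho>_def mult_ac)
qed

lemma potential_supersolution:
  assumes g: "continuous_on {0..} g" "\<And>t. t \<ge> 0 \<Longrightarrow> 0 \<le> g t"
  shows "continuous_on {0..} (\<lambda>r. a + potential N g r)" "a \<le> a + potential N g r"
    "mono_on {0..} (\<lambda>r. a + potential N g r)"
proof -
  show "continuous_on {0..} (\<lambda>r. a + potential N g r)"
    by (intro continuous_intros potential_continuous_on N1 g(1))
  show "a \<le> a + potential N g r"
    using potential_nonneg[of g N r] g(2) by simp
  show "mono_on {0..} (\<lambda>r. a + potential N g r)"
    by (intro mono_onI add_left_mono potential_mono_arg[OF N1 g(1)]) (auto intro: g(2))
qed

text \<open>The hypothesis on \<open>y\<close> is what monotone iterates satisfy, each lying below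
  the one two steps later. On a compact interval \<open>\<rho>\<close> is bounded by a constant
  \<open>P\<close>, so \<open>potential_locally_bounded\<close> applies with \<open>c * P\<close>
  and a bound independent of \<open>y\<close>.\<close>

lemma locally_bounded:
  "\<exists>B. \<forall>y. continuous_on {0..} y \<longrightarrow> (\<forall>t\<ge>0. 0 \<le> y t) \<longrightarrow>
    (\<forall>t\<in>{0..R}. y t \<le> b + potential N
        (\<lambda>t. p2 t * f2 (a + potential N (\<lambda>t. p1 t * f1 (y t)) t)) t) \<longrightarrow>
    (\<forall>r\<in>{0..R}. a + potential N (\<lambda>t. p1 t * f1 (y t)) r \<le> B)"
proof -
  obtain P where P: "P \<ge> 0" "\<And>t. t \<in> {0..R} \<Longrightarrow> \<rho> t \<le> P"
    using continuous_on_bounded_above[OF \<rho>_cont] by blast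
  have "0 \<le> c * P" using c P(1) by simp
  from potential_locally_bounded[OF N1 ab(1) k_cont k_nonneg k_pos k_inf this, of R]
  obtain B where B: "\<And>g. continuous_on {0..} g \<Longrightarrow> \<forall>t\<ge>0. 0 \<le> g t \<Longrightarrow>
    \<forall>t\<in>{0..R}. g t \<le> c * P * k (a + potential N g t) \<Longrightarrow> \<forall>r\<in>{0..R}. a + potential N g r \<le> B"
    by blast
  have "\<forall>r\<in>{0..R}. a + potential N (\<lambda>t. p1 t * f1 (y t)) r \<le> B"
    if y: "continuous_on {0..} y" "\<forall>t\<ge>0. 0 \<le> y t"
      "\<forall>t\<in>{0..R}. y t \<le> b + potential N
        (\<lambda>t. p2 t * f2 (a + potential N (\<lambda>t. p1 t * f1 (y t)) t)) t" for y
  proof -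
    let ?g = "\<lambda>t. p1 t * f1 (y t)"
    have g: "continuous_on {0..} ?g"
      by (rule continuous_on_weighted_comp[OF p_cont(1) f_cont(1) y(1)]) (use y(2) in simp)
    have g_nonneg: "0 \<le> ?g t" if "t \<ge> 0" for t
      using that y(2) by (intro mult_nonneg_nonneg p_nonneg(1) f_nonneg(1)) simp_all
    have "?g t \<le> c * P * k (a + potential N ?g t)" if t: "t \<in> {0..R}" for t
    proof -
      have pos: "0 \<le> k (a + potential N ?g t)"
        using potential_nonneg[of ?g N t] g_nonneg ab(1) by (intro k_nonneg) simp
      have "?g t \<le> c * \<rho> t * k (a + potential N ?g t)"
        using t y by (intro source_le potential_supersolution g g_nonneg) auto
      also have "\<dots> \<le> c * P * k (a + potential N ?g t)"
        using c P(2)[OF t] pos by (intro mult_right_mono mult_left_mono) auto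
      finally show ?thesis .
    qed
    then show ?thesis
      by (intro B[OF g] allI impI ballI g_nonneg)
  qed
  then show ?thesis by blast
qed

section \<open>Solutions of the integral system\<close>

context
  fixes u1 u2 :: "real \<Rightarrow> real"
  assumes u_cont: "continuous_on {0..} u1" "continuous_on {0..} u2"
    and u_nonneg: "\<And>r. r \<ge> 0 \<Longrightarrow> 0 \<le> u1 r" "\<And>r. r \<ge> 0 \<Longrightarrow> 0 \<le> u2 r"
    and u1_eq: "\<And>r. r \<ge> 0 \<Longrightarrow> u1 r = a + potential N (\<lambda>t. p1 t * f1 (u2 t)) r"
    and u2_eq: "\<And>r. r \<ge> 0 \<Longrightarrow> u2 r = b + potential N (\<lambda>t. p2 t * f2 (u1 t)) r"
begin

lemma source_cont: "continuous_on {0..} (\<lambda>t. p1 t * f1 (u2 t))"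
  by (rule continuous_on_weighted_comp[OF p_cont(1) f_cont(1) u_cont(2)]) (rule u_nonneg)

lemma source_nonneg: "t \<ge> 0 \<Longrightarrow> 0 \<le> p1 t * f1 (u2 t)"
  by (intro mult_nonneg_nonneg p_nonneg f_nonneg u_nonneg)

lemma u1_mono: "mono_on {0..} u1"
proof (rule mono_onI)
  fix r s :: real assume "r \<in> {0..}" "s \<in> {0..}" "r \<le> s"
  then show "u1 r \<le> u1 s"
    unfolding u1_eq[OF \<open>r \<in> {0..}\<close>[unfolded atLeast_iff]] u1_eq[OF \<open>s \<in> {0..}\<close>[unfolded atLeast_iff]]
    by (intro add_left_mono potential_mono_arg[OF N1 source_cont]) (auto intro: source_nonneg)
qed

lemma u1_ge: "r \<ge> 0 \<Longrightarrow> a \<le> u1 r"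
  by (subst u1_eq) (auto intro!: potential_nonneg source_nonneg)

text \<open>Since \<open>\<omega>\<close> and the potential of \<open>p2\<close> are nondecreasing
  on the half-line, \<open>\<rho>\<close> inherits the eventual monotonicity of the weight from
  \<open>p1\<close>. The dichotomy bounds \<open>P2\<close>, and
  \<open>potential_globally_bounded\<close> applies to the source of \<open>u1\<close>.\<close>

lemma u1_finite_limit:
  assumes "weight_nondecreasing_for_large N p1" "\<epsilon> > 0"
    and P2: "\<not> has_infinite_limit (P2 N p1 p2 \<omega> \<epsilon>)"
  shows "has_finite_limit u1"
proof -
  obtain R where R: "mono_on {R..} (\<lambda>r. r ^ (2 * N - 2) * p1 r)"
    using assms(1) unfolding weight_nondecreasing_for_large_def by blast
  \<comment> \<open>\<open>R\<close> may be negative, whereas the nonnegativity of \<open>p1\<close>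
    is available on the half-line only.\<close>
  have mono: "mono_on {max R 0..} (\<lambda>r. r ^ (2 * N - 2) * \<rho> r)"
  proof (rule mono_onI)
    fix r s :: real assume rs: "r \<in> {max R 0..}" "s \<in> {max R 0..}" "r \<le> s"
    have "r ^ (2 * N - 2) * p1 r \<le> s ^ (2 * N - 2) * p1 s"
      using rs by (intro mono_onD[OF R]) auto
    moreover have "\<omega> (1 + potential N p2 r) \<le> \<omega> (1 + potential N p2 s)"
    proof (rule mono_onD[OF strict_mono_on_imp_mono_on[OF \<omega>_incr]])
      show "1 + potential N p2 r \<le> 1 + potential N p2 s"
        using rs by (intro add_left_mono potential_mono_arg[OF N1 p_cont(2)]) (auto intro: p_nonneg)
    qed (use potential_p2_nonneg[of r] potential_p2_nonneg[of s] in auto)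
    ultimately have "r ^ (2 * N - 2) * p1 r * \<omega> (1 + potential N p2 r)
        \<le> s ^ (2 * N - 2) * p1 s * \<omega> (1 + potential N p2 s)"
      by (rule mult_mono)
        (use rs in \<open>auto intro!: mult_nonneg_nonneg \<omega>_potential_nonneg p_nonneg\<close>)
    then show "r ^ (2 * N - 2) * \<rho> r \<le> s ^ (2 * N - 2) * \<rho> s"
      by (simp add: \<rho>_def mult.assoc)
  qed
  have contZ: "continuous_on {0..} (\<lambda>z. z powr (1 + \<epsilon>) * \<rho> z)"
    using \<open>\<epsilon> > 0\<close> by (intro continuous_intros continuous_on_powr' \<rho>_cont) auto
  have "mono_on {0..} (P2 N p1 p2 \<omega> \<epsilon>)"
    unfolding P2_eq_potential \<rho>_def[symmetric]
    by (intro mono_onI primitive_mono[OF contZ]) (auto intro!: mult_nonneg_nonneg \<rho>_nonneg)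
  with P2 obtain B0 where "\<forall>r\<ge>0. P2 N p1 p2 \<omega> \<epsilon> r \<le> B0"
    using mono_has_infinite_limit_or_bounded by blast
  then have B0: "integral {0..r} (\<lambda>z. z powr (1 + \<epsilon>) * \<rho> z) \<le> B0" if "r \<ge> 0" for r
    using that by (simp add: P2_eq_potential \<rho>_def)
  have le: "p1 t * f1 (u2 t) \<le> c * \<rho> t * k (a + potential N (\<lambda>t. p1 t * f1 (u2 t)) t)"
    if t: "t \<ge> 0" for t
  proof -
    have "p1 t * f1 (u2 t) \<le> c * \<rho> t * k (u1 t)"
      using t u2_eq by (intro source_le u_cont u1_ge u1_mono u_nonneg) auto
    then show ?thesis using u1_eq t by simp
  qed
  have "\<exists>B. \<forall>r\<ge>0. a + potential N (\<lambda>t. p1 t * f1 (u2 t)) r \<le> B"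
    using c by (intro potential_globally_bounded[OF N ab(1) k_cont k_nonneg k_pos k_inf _ source_cont
          source_nonneg \<rho>_cont \<rho>_nonneg le mono \<open>\<epsilon> > 0\<close> B0]) auto
  then show ?thesis
    using mono_bounded_has_finite_limit[OF u1_mono] u1_eq by auto
qed

text \<open>Passing the bound \<open>u1 \<ge> a\<close> once through both equations reproduces
  exactly the nested integrals of \<open>P1\<close>.\<close>

lemma u1_infinite_limit:
  assumes "has_infinite_limit (P1 N p1 p2 f1 f2 a b)"
  shows "has_infinite_limit u1"
proof -
  have "P1 N p1 p2 f1 f2 a b r \<le> u1 r" if r: "r \<ge> 0" for r
  proof -
    have low: "b + f2 a * potential N p2 t \<le> u2 t" if t: "t \<ge> 0" for t
    proof -
      have "potential N (\<lambda>t. f2 a * p2 t) t \<le> potential N (\<lambda>t. p2 t * f2 (u1 t)) t"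
      proof (rule potential_mono[OF N1])
        show "continuous_on {0..} (\<lambda>t. p2 t * f2 (u1 t))"
          by (rule continuous_on_weighted_comp[OF p_cont(2) f_cont(2) u_cont(1)]) (rule u_nonneg)
        show "continuous_on {0..} (\<lambda>t. f2 a * p2 t)"
          by (intro continuous_intros p_cont)
        fix s :: real assume s: "0 \<le> s"
        have "f2 a \<le> f2 (u1 s)"
          using u1_ge[OF s] ab u_nonneg(1)[OF s] by (intro mono_onD[OF f_mono(2)]) auto
        then show "f2 a * p2 s \<le> p2 s * f2 (u1 s)"
          using mult_left_mono[OF _ p_nonneg(2)[OF s]] by (simp add: mult.commute[of "f2 a"])
      qed
      then show ?thesis using u2_eq[OF t] by (simp add: potential_cmult)
    qed
    have low_nonneg: "0 \<le> b + f2 a * potential N p2 t" for t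
      using ab f_nonneg(2)[of a] potential_p2_nonneg[of t] by simp
    have "potential N (\<lambda>t. p1 t * f1 (b + f2 a * potential N p2 t)) r
        \<le> potential N (\<lambda>t. p1 t * f1 (u2 t)) r"
    proof (rule potential_mono[OF N1 _ source_cont])
      show "continuous_on {0..} (\<lambda>t. p1 t * f1 (b + f2 a * potential N p2 t))"
      proof (rule continuous_on_weighted_comp[OF p_cont(1) f_cont(1)])
        show "continuous_on {0..} (\<lambda>t. b + f2 a * potential N p2 t)"
          by (intro continuous_intros potential_continuous_on N1 p_cont)
      qed (rule low_nonneg)
      fix t :: real assume t: "0 \<le> t"
      have "f1 (b + f2 a * potential N p2 t) \<le> f1 (u2 t)"
        using low[OF t] low_nonneg u_nonneg(2)[OF t] by (intro mono_onD[OF f_mono(1)]) auto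
      then show "p1 t * f1 (b + f2 a * potential N p2 t) \<le> p1 t * f1 (u2 t)"
        using p_nonneg(1)[OF t] by (rule mult_left_mono)
    qed
    then show ?thesis using u1_eq[OF r] ab by (simp add: P1_eq_potential)
  qed
  then have "\<forall>\<^sub>F r in at_top. P1 N p1 p2 f1 f2 a b r \<le> u1 r"
    unfolding eventually_at_top_linorder by blast
  with assms show ?thesis
    unfolding has_infinite_limit_def by (rule filterlim_at_top_mono)
qed

end

end

section \<open>Existence by monotone iteration\<close>

locale elliptic_system =
  one: controlled_component N a b c1 p1 p2 f1 f2 h1 \<omega>1 +
  two: controlled_component N b a c2 p2 p1 f2 f1 h2 \<omega>2
  for N a b c1 c2 p1 p2 f1 f2 h1 h2 \<omega>1 \<omega>2
begin

text \<open>Both components are updated simultaneously from the previous pair. The starting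
  constants are the central values, which lie below all later iterates.\<close>

primrec iterate :: "nat \<Rightarrow> (real \<Rightarrow> real) \<times> (real \<Rightarrow> real)" where
  "iterate 0 = (\<lambda>_. a, \<lambda>_. b)"
| "iterate (Suc k) =
    (\<lambda>r. a + potential N (\<lambda>t. p1 t * f1 (snd (iterate k) t)) r,
     \<lambda>r. b + potential N (\<lambda>t. p2 t * f2 (fst (iterate k) t)) r)"

abbreviation "x1 k \<equiv> fst (iterate k)"
abbreviation "x2 k \<equiv> snd (iterate k)"

text \<open>The properties are proved together because the source of each component involves the
  other. The lower bounds extend to negative \<open>r\<close>, where the potential integrates over
  an empty interval.\<close>

lemma iterate_basic:
  "continuous_on {0..} (x1 k) \<and> continuous_on {0..} (x2 k) \<and> (\<forall>r. a \<le> x1 k r) \<and> (\<forall>r. b \<le> x2 k r)"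
proof (induction k)
  case (Suc k)
  have nonneg: "0 \<le> x1 k r" "0 \<le> x2 k r" for r
    using Suc.IH one.ab by (meson order_trans less_imp_le)+
  have cont: "continuous_on {0..} (\<lambda>t. p1 t * f1 (x2 k t))" "continuous_on {0..} (\<lambda>t. p2 t * f2 (x1 k t))"
    using Suc.IH nonneg
    by (auto intro!: continuous_on_weighted_comp[OF one.p_cont(1) one.f_cont(1)]
        continuous_on_weighted_comp[OF one.p_cont(2) one.f_cont(2)])
  have pos: "0 \<le> p1 t * f1 (x2 k t)" "0 \<le> p2 t * f2 (x1 k t)" if "t \<ge> 0" for t
    using that nonneg by (auto intro!: mult_nonneg_nonneg one.p_nonneg one.f_nonneg)
  show ?case
    using one.potential_supersolution(1,2)[OF cont(1) pos(1)]
      two.potential_supersolution(1,2)[OF cont(2) pos(2)] by simp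
qed simp

lemma iterate_cont: "continuous_on {0..} (x1 k)" "continuous_on {0..} (x2 k)"
  and iterate_ge: "a \<le> x1 k r" "b \<le> x2 k r"
  using iterate_basic by auto

lemma iterate_nonneg: "0 \<le> x1 k r" "0 \<le> x2 k r"
  using iterate_ge one.ab by (meson order_trans less_imp_le)+

lemma source_iterate_cont:
  "continuous_on {0..} (\<lambda>t. p1 t * f1 (x2 k t))" "continuous_on {0..} (\<lambda>t. p2 t * f2 (x1 k t))"
  by (auto intro!: continuous_on_weighted_comp[OF one.p_cont(1) one.f_cont(1)]
      continuous_on_weighted_comp[OF one.p_cont(2) one.f_cont(2)] iterate_cont iterate_nonneg)

lemma source_mono:
  "t \<ge> 0 \<Longrightarrow> 0 \<le> y \<Longrightarrow> y \<le> z \<Longrightarrow> p1 t * f1 y \<le> p1 t * f1 z"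
  "t \<ge> 0 \<Longrightarrow> 0 \<le> y \<Longrightarrow> y \<le> z \<Longrightarrow> p2 t * f2 y \<le> p2 t * f2 z"
  by (auto intro!: mult_left_mono one.p_nonneg mono_onD[OF one.f_mono(1)] mono_onD[OF one.f_mono(2)])

lemma iterate_mono_Suc:
  "r \<ge> 0 \<Longrightarrow> x1 k r \<le> x1 (Suc k) r \<and> x2 k r \<le> x2 (Suc k) r"
\<comment> \<open>The potential at \<open>r\<close> needs the induction hypothesis on all of
  \<open>{0..r}\<close>.\<close>
proof (induction k arbitrary: r)
  case 0
  then show ?case
    using iterate_ge[of "Suc 0" r] by simp
next
  case (Suc k)
  have "potential N (\<lambda>t. p1 t * f1 (x2 k t)) r \<le> potential N (\<lambda>t. p1 t * f1 (x2 (Suc k) t)) r"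
    using Suc.IH
    by (intro potential_mono one.N1 source_iterate_cont source_mono iterate_nonneg) auto
  moreover have "potential N (\<lambda>t. p2 t * f2 (x1 k t)) r \<le> potential N (\<lambda>t. p2 t * f2 (x1 (Suc k) t)) r"
    using Suc.IH
    by (intro potential_mono one.N1 source_iterate_cont source_mono iterate_nonneg) auto
  ultimately show ?case by simp
qed

lemma iterate_bounded:
  "\<exists>B. \<forall>k. \<forall>t\<in>{0..R}. x1 k t \<le> B" "\<exists>B. \<forall>k. \<forall>t\<in>{0..R}. x2 k t \<le> B"
proof -
  \<comment> \<open>The right-hand sides are the iterates two steps later, so monotonicity is used
    twice.\<close>
  have step2: "x2 k t \<le> b + potential N (\<lambda>t. p2 t * f2 (x1 (Suc k) t)) t"
    and step1: "x1 k t \<le> a + potential N (\<lambda>t. p1 t * f1 (x2 (Suc k) t)) t" if "t \<in> {0..R}" for k t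
    using that iterate_mono_Suc[of t k] iterate_mono_Suc[of t "Suc k"] by auto
  obtain B1 where B1: "\<And>y r. continuous_on {0..} y \<Longrightarrow> \<forall>t\<ge>0. 0 \<le> y t \<Longrightarrow>
    \<forall>t\<in>{0..R}. y t \<le> b + potential N
        (\<lambda>t. p2 t * f2 (a + potential N (\<lambda>t. p1 t * f1 (y t)) t)) t \<Longrightarrow> r \<in> {0..R} \<Longrightarrow>
    a + potential N (\<lambda>t. p1 t * f1 (y t)) r \<le> B1"
    using one.locally_bounded[of R] by blast
  obtain B2 where B2: "\<And>y r. continuous_on {0..} y \<Longrightarrow> \<forall>t\<ge>0. 0 \<le> y t \<Longrightarrow>
    \<forall>t\<in>{0..R}. y t \<le> a + potential N
        (\<lambda>t. p1 t * f1 (b + potential N (\<lambda>t. p2 t * f2 (y t)) t)) t \<Longrightarrow> r \<in> {0..R} \<Longrightarrow>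
    b + potential N (\<lambda>t. p2 t * f2 (y t)) r \<le> B2"
    using two.locally_bounded[of R] by blast
  have "x1 (Suc k) t \<le> B1" if "t \<in> {0..R}" for k t
    using B1[of "x2 k" t] that iterate_cont iterate_nonneg step2[of _ k] by simp
  then have "x1 k t \<le> B1" if "t \<in> {0..R}" for k t
    using that iterate_mono_Suc[of t k] by (meson atLeastAtMost_iff order_trans)
  then show "\<exists>B. \<forall>k. \<forall>t\<in>{0..R}. x1 k t \<le> B" by blast
  have "x2 (Suc k) t \<le> B2" if "t \<in> {0..R}" for k t
    using B2[of "x1 k" t] that iterate_cont iterate_nonneg step1[of _ k] by simp
  then have "x2 k t \<le> B2" if "t \<in> {0..R}" for k t
    using that iterate_mono_Suc[of t k] by (meson atLeastAtMost_iff order_trans)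
  then show "\<exists>B. \<forall>k. \<forall>t\<in>{0..R}. x2 k t \<le> B" by blast
qed

text \<open>Bounded increasing iterates converge pointwise. Dominated convergence carries the limit
  through both potentials, and the resulting equations make the limits continuous.\<close>

lemma integral_solution_exists:
  obtains u1 u2 where "continuous_on {0..} u1" "continuous_on {0..} u2"
    "\<And>r. r \<ge> 0 \<Longrightarrow> 0 \<le> u1 r" "\<And>r. r \<ge> 0 \<Longrightarrow> 0 \<le> u2 r"
    "\<And>r. r \<ge> 0 \<Longrightarrow> u1 r = a + potential N (\<lambda>t. p1 t * f1 (u2 t)) r"
    "\<And>r. r \<ge> 0 \<Longrightarrow> u2 r = b + potential N (\<lambda>t. p2 t * f2 (u1 t)) r"
proof -
  define u1 where "u1 r = lim (\<lambda>k. x1 k r)" for r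
  define u2 where "u2 r = lim (\<lambda>k. x2 k r)" for r
  have convergent: "convergent (\<lambda>k. x1 k r)" "convergent (\<lambda>k. x2 k r)" if r: "r \<ge> 0" for r
  proof -
    obtain B1 B2 where "\<And>k. x1 k r \<le> B1" "\<And>k. x2 k r \<le> B2"
      using iterate_bounded[of r] r by (metis atLeastAtMost_iff order_refl)
    moreover have "incseq (\<lambda>k. x1 k r)" "incseq (\<lambda>k. x2 k r)"
      by (intro incseq_SucI conjunct1[OF iterate_mono_Suc[OF r]] conjunct2[OF iterate_mono_Suc[OF r]])+
    ultimately show "convergent (\<lambda>k. x1 k r)" "convergent (\<lambda>k. x2 k r)"
      by (metis incseq_convergent convergentI)+
  qed
  then have L: "(\<lambda>k. x1 k r) \<longlonglongrightarrow> u1 r" "(\<lambda>k. x2 k r) \<longlonglongrightarrow> u2 r" if "r \<ge> 0" for r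
    using that by (auto simp: u1_def u2_def convergent_LIMSEQ_iff)
  have nonneg: "t \<ge> 0 \<Longrightarrow> 0 \<le> x1 k t" "t \<ge> 0 \<Longrightarrow> 0 \<le> x2 k t" for k t
    by (rule iterate_nonneg)+
  have cont1: "continuous_on {0..} (potential N (\<lambda>t. p1 t * f1 (u2 t)))"
    by (rule potential_weighted_comp_limit(1)[where p = p1 and f = f1 and X = x2 and L = u2])
      (fact one.N1 one.p_cont(1) one.p_nonneg(1) one.f_cont(1) one.f_mono(1) one.f_nonneg(1)
        iterate_cont(2) nonneg(2) iterate_bounded(2) L(2))+
  have lim1: "(\<lambda>k. potential N (\<lambda>t. p1 t * f1 (x2 k t)) r) \<longlonglongrightarrow> potential N (\<lambda>t. p1 t * f1 (u2 t)) r"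
    if r: "r \<ge> 0" for r
    by (rule potential_weighted_comp_limit(2)[where p = p1 and f = f1 and X = x2 and L = u2])
      (fact one.N1 one.p_cont(1) one.p_nonneg(1) one.f_cont(1) one.f_mono(1) one.f_nonneg(1)
        iterate_cont(2) nonneg(2) iterate_bounded(2) L(2) r)+
  have cont2: "continuous_on {0..} (potential N (\<lambda>t. p2 t * f2 (u1 t)))"
    by (rule potential_weighted_comp_limit(1)[where p = p2 and f = f2 and X = x1 and L = u1])
      (fact one.N1 one.p_cont(2) one.p_nonneg(2) one.f_cont(2) one.f_mono(2) one.f_nonneg(2)
        iterate_cont(1) nonneg(1) iterate_bounded(1) L(1))+
  have lim2: "(\<lambda>k. potential N (\<lambda>t. p2 t * f2 (x1 k t)) r) \<longlonglongrightarrow> potential N (\<lambda>t. p2 t * f2 (u1 t)) r"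
    if r: "r \<ge> 0" for r
    by (rule potential_weighted_comp_limit(2)[where p = p2 and f = f2 and X = x1 and L = u1])
      (fact one.N1 one.p_cont(2) one.p_nonneg(2) one.f_cont(2) one.f_mono(2) one.f_nonneg(2)
        iterate_cont(1) nonneg(1) iterate_bounded(1) L(1) r)+
  have eq1: "u1 r = a + potential N (\<lambda>t. p1 t * f1 (u2 t)) r" if r: "r \<ge> 0" for r
  proof (rule LIMSEQ_unique)
    show "(\<lambda>k. x1 (Suc k) r) \<longlonglongrightarrow> u1 r"
      using L(1)[OF r] by (rule LIMSEQ_Suc)
    show "(\<lambda>k. x1 (Suc k) r) \<longlonglongrightarrow> a + potential N (\<lambda>t. p1 t * f1 (u2 t)) r"
      using lim1[OF r] by (auto intro: tendsto_intros)
  qed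
  have eq2: "u2 r = b + potential N (\<lambda>t. p2 t * f2 (u1 t)) r" if r: "r \<ge> 0" for r
  proof (rule LIMSEQ_unique)
    show "(\<lambda>k. x2 (Suc k) r) \<longlonglongrightarrow> u2 r"
      using L(2)[OF r] by (rule LIMSEQ_Suc)
    show "(\<lambda>k. x2 (Suc k) r) \<longlonglongrightarrow> b + potential N (\<lambda>t. p2 t * f2 (u1 t)) r"
      using lim2[OF r] by (auto intro: tendsto_intros)
  qed
  show thesis
  proof (rule that)
    show "continuous_on {0..} u1"
      by (rule continuous_on_eq[OF continuous_on_add[OF continuous_on_const cont1]]) (use eq1 in auto)
    show "continuous_on {0..} u2"
      by (rule continuous_on_eq[OF continuous_on_add[OF continuous_on_const cont2]]) (use eq2 in auto)
    show "0 \<le> u1 r" if "r \<ge> 0" for r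
      using LIMSEQ_le_const[OF L(1)[OF that]] iterate_nonneg(1) by blast
    show "0 \<le> u2 r" if "r \<ge> 0" for r
      using LIMSEQ_le_const[OF L(2)[OF that]] iterate_nonneg(2) by blast
  qed (rule eq1 eq2; assumption)+
qed

end

section \<open>Passage between the elliptic and the integral system\<close>

lemma C2_halfline_continuous_on:
  assumes "C2_halfline u"
  shows "continuous_on {0..} u"
proof -
  obtain v where "\<And>r. r \<ge> 0 \<Longrightarrow> (u has_real_derivative v r) (at r within {0..})"
    using assms unfolding C2_halfline_def by blast
  from DERIV_continuous[OF this] show ?thesis
    by (simp add: continuous_on_eq_continuous_within)
qed

lemma nonneg_solution_integral_equation:
  assumes sol: "nonneg_solution TYPE('n::finite) p1 p2 f1 f2 a b u1 u2" and N: "CARD('n) \<ge> 2"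
    and p: "continuous_on {0..} p1" "continuous_on {0..} p2"
    and f: "continuous_on {0..} f1" "continuous_on {0..} f2"
  shows "continuous_on {0..} u1" "continuous_on {0..} u2"
    "\<And>r. r \<ge> 0 \<Longrightarrow> 0 \<le> u1 r" "\<And>r. r \<ge> 0 \<Longrightarrow> 0 \<le> u2 r"
    "\<And>r. r \<ge> 0 \<Longrightarrow> u1 r = a + potential CARD('n) (\<lambda>t. p1 t * f1 (u2 t)) r"
    "\<And>r. r \<ge> 0 \<Longrightarrow> u2 r = b + potential CARD('n) (\<lambda>t. p2 t * f2 (u1 t)) r"
proof -
  have C2: "C2_halfline u1" "C2_halfline u2"
    and lap: "has_laplacian (\<lambda>y. u1 (norm y)) (p1 (norm x) * f1 (u2 (norm x))) x"
      "has_laplacian (\<lambda>y. u2 (norm y)) (p2 (norm x) * f2 (u1 (norm x))) x"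
    and init: "u1 0 = a" "u2 0 = b" for x :: "real ^ 'n"
    using sol unfolding nonneg_solution_def entire_radial_solution_def by blast+
  show cont: "continuous_on {0..} u1" "continuous_on {0..} u2"
    using C2 by (auto intro: C2_halfline_continuous_on)
  show nonneg: "\<And>r. r \<ge> 0 \<Longrightarrow> 0 \<le> u1 r" "\<And>r. r \<ge> 0 \<Longrightarrow> 0 \<le> u2 r"
    using sol unfolding nonneg_solution_def by blast+
  have src: "continuous_on {0..} (\<lambda>t. p1 t * f1 (u2 t))" "continuous_on {0..} (\<lambda>t. p2 t * f2 (u1 t))"
    by (auto intro!: continuous_on_weighted_comp[OF p(1) f(1)] continuous_on_weighted_comp[OF p(2) f(2)]
        cont nonneg)
  show "u1 r = a + potential CARD('n) (\<lambda>t. p1 t * f1 (u2 t)) r" if "r \<ge> 0" for r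
    using radial_solution_eq_potential[OF N C2(1) src(1) lap(1) that] init by simp
  show "u2 r = b + potential CARD('n) (\<lambda>t. p2 t * f2 (u1 t)) r" if "r \<ge> 0" for r
    using radial_solution_eq_potential[OF N C2(2) src(2) lap(2) that] init by simp
qed

text \<open>The pair exhibited consists of the right-hand sides: they agree with \<open>u1\<close>
  and \<open>u2\<close> on the half-line, and the lemmas on potentials apply to them
  literally.\<close>

lemma nonneg_solution_if_integral_equation:
  assumes p: "continuous_on {0..} p1" "continuous_on {0..} p2"
    and f: "continuous_on {0..} f1" "continuous_on {0..} f2"
    and u: "continuous_on {0..} u1" "continuous_on {0..} u2"
      "\<And>r. r \<ge> 0 \<Longrightarrow> 0 \<le> u1 r" "\<And>r. r \<ge> 0 \<Longrightarrow> 0 \<le> u2 r"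
      "\<And>r. r \<ge> 0 \<Longrightarrow> u1 r = a + potential CARD('n) (\<lambda>t. p1 t * f1 (u2 t)) r"
      "\<And>r. r \<ge> 0 \<Longrightarrow> u2 r = b + potential CARD('n) (\<lambda>t. p2 t * f2 (u1 t)) r"
  shows "nonneg_solution TYPE('n::finite) p1 p2 f1 f2 a b
    (\<lambda>r. a + potential CARD('n) (\<lambda>t. p1 t * f1 (u2 t)) r)
    (\<lambda>r. b + potential CARD('n) (\<lambda>t. p2 t * f2 (u1 t)) r)"
proof -
  have N: "CARD('n) \<ge> 1" by (simp add: Suc_leI)
  have src: "continuous_on {0..} (\<lambda>t. p1 t * f1 (u2 t))" "continuous_on {0..} (\<lambda>t. p2 t * f2 (u1 t))"
    by (auto intro!: continuous_on_weighted_comp[OF p(1) f(1)] continuous_on_weighted_comp[OF p(2) f(2)]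
        u(1-4))
  show ?thesis
    unfolding nonneg_solution_def entire_radial_solution_def
  proof (intro conjI allI impI)
    show "C2_halfline (\<lambda>r. a + potential CARD('n) (\<lambda>t. p1 t * f1 (u2 t)) r)"
      "C2_halfline (\<lambda>r. b + potential CARD('n) (\<lambda>t. p2 t * f2 (u1 t)) r)"
      by (rule C2_halfline_potential[OF N src(1)] C2_halfline_potential[OF N src(2)])+
    fix x :: "real ^ 'n"
    show "has_laplacian (\<lambda>y. a + potential CARD('n) (\<lambda>t. p1 t * f1 (u2 t)) (norm y))
        (p1 (norm x) * f1 (b + potential CARD('n) (\<lambda>t. p2 t * f2 (u1 t)) (norm x))) x"
      using potential_has_laplacian[OF src(1), of a x] unfolding u(6)[OF norm_ge_zero[of x]] .
    show "has_laplacian (\<lambda>y. b + potential CARD('n) (\<lambda>t. p2 t * f2 (u1 t)) (norm y))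
        (p2 (norm x) * f2 (a + potential CARD('n) (\<lambda>t. p1 t * f1 (u2 t)) (norm x))) x"
      using potential_has_laplacian[OF src(2), of b x] unfolding u(5)[OF norm_ge_zero[of x]] .
  next
    fix r :: real assume r: "0 \<le> r"
    show "0 \<le> a + potential CARD('n) (\<lambda>t. p1 t * f1 (u2 t)) r"
      unfolding u(5)[OF r, symmetric] by (rule u(3)[OF r])
    show "0 \<le> b + potential CARD('n) (\<lambda>t. p2 t * f2 (u1 t)) r"
      unfolding u(6)[OF r, symmetric] by (rule u(4)[OF r])
  qed simp_all
qed

section \<open>Combination of existence with the bounds for both components\<close>

theorem theorem1p1:
  fixes N :: nat and a b c1 c2 :: real
    and p1 p2 f1 f2 h1 h2 \<omega>1 \<omega>2 :: "real \<Rightarrow> real"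
  assumes N: "N = CARD('n::finite)" "N \<ge> 3"
    and ab: "a > 0" "b > 0"
    and P1_cont: "continuous_on {0..} p1" "continuous_on {0..} p2"
    and P1_nonneg: "\<And>r. r \<ge> 0 \<Longrightarrow> p1 r \<ge> 0" "\<And>r. r \<ge> 0 \<Longrightarrow> p2 r \<ge> 0"
    and C1_cont: "continuous_on {0..} f1" "continuous_on {0..} f2"
    and C1_mono: "mono_on {0..} f1" "mono_on {0..} f2"
    and C1_zero: "f1 0 = 0" "f2 0 = 0"
    and C1_pos: "\<And>s. s > 0 \<Longrightarrow> f1 s > 0" "\<And>s. s > 0 \<Longrightarrow> f2 s > 0"
    and C2_pos: "c1 > 0" "c2 > 0"
    and C2_cont: "continuous_on {0..} h1" "continuous_on {0..} h2"
      "continuous_on {0..} \<omega>1" "continuous_on {0..} \<omega>2"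
    and C2_incr: "strict_mono_on {0..} h1" "strict_mono_on {0..} h2"
      "strict_mono_on {0..} \<omega>1" "strict_mono_on {0..} \<omega>2"
    and C2_nonneg: "\<And>t. t \<ge> 0 \<Longrightarrow> h1 t \<ge> 0" "\<And>t. t \<ge> 0 \<Longrightarrow> h2 t \<ge> 0"
      "\<And>t. t \<ge> 0 \<Longrightarrow> \<omega>1 t \<ge> 0" "\<And>t. t \<ge> 0 \<Longrightarrow> \<omega>2 t \<ge> 0"
    and C2_f1: "\<And>t w. w \<ge> 1 \<Longrightarrow> t \<ge> M1 f2 a b * f2 a \<Longrightarrow> f1 (t * w) \<le> c1 * h1 t * \<omega>1 w"
    and C2_f2: "\<And>t w. w \<ge> 1 \<Longrightarrow> t \<ge> M2 f1 a b * f1 b \<Longrightarrow> f2 (t * w) \<le> c2 * h2 t * \<omega>2 w"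
    and H_inf: "has_infinite_limit (H1 h1 f2 a b)" "has_infinite_limit (H2 h2 f1 a b)"
  shows
    "(\<exists>u1 u2. nonneg_solution TYPE('n) p1 p2 f1 f2 a b u1 u2) \<and>
     (weight_nondecreasing_for_large N p1 \<and> weight_nondecreasing_for_large N p2 \<and>
        (\<exists>\<epsilon>>0. has_finite_limit (P2 N p1 p2 \<omega>1 \<epsilon>) \<and> has_finite_limit (Q2 N p1 p2 \<omega>2 \<epsilon>)) \<longrightarrow>
        (\<forall>u1 u2. nonneg_solution TYPE('n) p1 p2 f1 f2 a b u1 u2 \<longrightarrow>
           has_finite_limit u1 \<and> has_finite_limit u2)) \<and>
     (has_infinite_limit (P1 N p1 p2 f1 f2 a b) \<and> has_infinite_limit (Q1 N p1 p2 f1 f2 a b) \<longrightarrow>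
        (\<forall>u1 u2. nonneg_solution TYPE('n) p1 p2 f1 f2 a b u1 u2 \<longrightarrow>
           has_infinite_limit u1 \<and> has_infinite_limit u2)) \<and>
     (weight_nondecreasing_for_large N p1 \<and>
        (\<exists>\<epsilon>>0. has_finite_limit (P2 N p1 p2 \<omega>1 \<epsilon>)) \<and>
        has_infinite_limit (Q1 N p1 p2 f1 f2 a b) \<longrightarrow>
        (\<forall>u1 u2. nonneg_solution TYPE('n) p1 p2 f1 f2 a b u1 u2 \<longrightarrow>
           has_finite_limit u1 \<and> has_infinite_limit u2)) \<and>
     (weight_nondecreasing_for_large N p2 \<and>
        has_infinite_limit (P1 N p1 p2 f1 f2 a b) \<and>
        (\<exists>\<epsilon>>0. has_finite_limit (Q2 N p1 p2 \<omega>2 \<epsilon>)) \<longrightarrow>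
        (\<forall>u1 u2. nonneg_solution TYPE('n) p1 p2 f1 f2 a b u1 u2 \<longrightarrow>
           has_infinite_limit u1 \<and> has_finite_limit u2)) \<and>
     ((\<exists>u1 u2. nonneg_solution TYPE('n) p1 p2 f1 f2 a b u1 u2 \<and> large u1 u2) \<and>
        weight_nondecreasing_for_large N p1 \<and> weight_nondecreasing_for_large N p2 \<longrightarrow>
        (\<forall>\<epsilon>>0. has_infinite_limit (P2 N p1 p2 \<omega>1 \<epsilon>) \<and> has_infinite_limit (Q2 N p1 p2 \<omega>2 \<epsilon>)))"
proof -
  interpret elliptic_system N a b c1 c2 p1 p2 f1 f2 h1 h2 \<omega>1 \<omega>2
  proof unfold_locales
    show "f2 (t * w) \<le> c2 * h2 t * \<omega>2 w" if "1 \<le> w" "M1 f1 b a * f1 b \<le> t" for t w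
      using C2_f2 that by (simp add: M1_def M2_def)
    \<comment> \<open>The second instance exchanges the components, and \<open>M2 f1 a b\<close>
      unfolds to the same expression as \<open>M1 f1 b a\<close>.\<close>
    have "H1 h2 f1 b a = H2 h2 f1 a b"
      by (rule ext) (simp add: H1_def H2_def M1_def M2_def)
    then show "has_infinite_limit (H1 h2 f1 b a)" using H_inf(2) by simp
  qed (fact assms)+
  have Q1: "Q1 N p1 p2 f1 f2 a b = P1 N p2 p1 f2 f1 b a"
    by (simp add: Q1_def[abs_def] P1_def[abs_def] G1_def[abs_def] G2_def[abs_def])
  have Q2: "Q2 N p1 p2 \<omega>2 \<epsilon> = P2 N p2 p1 \<omega>2 \<epsilon>" for \<epsilon>
    by (simp add: Q2_def[abs_def] P2_def[abs_def])
  have N2: "CARD('n) \<ge> 2" using N by simp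
  let ?sol = "nonneg_solution TYPE('n) p1 p2 f1 f2 a b"
  have ex: "\<exists>u1 u2. ?sol u1 u2"
  proof -
    obtain u1 u2 where "continuous_on {0..} u1" "continuous_on {0..} u2"
      "\<And>r. r \<ge> 0 \<Longrightarrow> 0 \<le> u1 r" "\<And>r. r \<ge> 0 \<Longrightarrow> 0 \<le> u2 r"
      "\<And>r. r \<ge> 0 \<Longrightarrow> u1 r = a + potential N (\<lambda>t. p1 t * f1 (u2 t)) r"
      "\<And>r. r \<ge> 0 \<Longrightarrow> u2 r = b + potential N (\<lambda>t. p2 t * f2 (u1 t)) r"
      using integral_solution_exists by blast
    from nonneg_solution_if_integral_equation[OF P1_cont C1_cont this[unfolded N(1)]]
    show ?thesis by blast
  qed
  \<comment> \<open>Negated divergence is assumed so that the contrapositive yields divergence of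
    \<open>P2\<close> for a large solution.\<close>
  have fin1: "has_finite_limit u1"
    if "weight_nondecreasing_for_large N p1" "\<epsilon> > 0" "\<not> has_infinite_limit (P2 N p1 p2 \<omega>1 \<epsilon>)" "?sol u1 u2"
    for \<epsilon> u1 u2
    using one.u1_finite_limit[OF nonneg_solution_integral_equation[OF that(4) N2 P1_cont C1_cont, folded N(1)]
        that(1-3)] .
  have fin2: "has_finite_limit u2"
    if "weight_nondecreasing_for_large N p2" "\<epsilon> > 0" "\<not> has_infinite_limit (P2 N p2 p1 \<omega>2 \<epsilon>)" "?sol u1 u2"
    for \<epsilon> u1 u2
    \<comment> \<open>The permutation of the facts exchanges the two components.\<close>
    using two.u1_finite_limit[OF nonneg_solution_integral_equation(2,1,4,3,6,5)[OF that(4) N2 P1_cont C1_cont, folded N(1)]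
        that(1-3)] .
  have inf1: "has_infinite_limit u1" if "has_infinite_limit (P1 N p1 p2 f1 f2 a b)" "?sol u1 u2" for u1 u2
    using one.u1_infinite_limit[OF nonneg_solution_integral_equation[OF that(2) N2 P1_cont C1_cont, folded N(1)]
        that(1)] .
  have inf2: "has_infinite_limit u2" if "has_infinite_limit (P1 N p2 p1 f2 f1 b a)" "?sol u1 u2" for u1 u2
    using two.u1_infinite_limit[OF nonneg_solution_integral_equation(2,1,4,3,6,5)[OF that(2) N2 P1_cont C1_cont, folded N(1)]
        that(1)] .
  \<comment> \<open>This links finite limits of \<open>P2\<close> to the negated divergence in
    \<open>fin1\<close> and \<open>fin2\<close>, and lets a finite limit of a component contradict
    largeness.\<close>
  have excl: "has_finite_limit F \<Longrightarrow> \<not> has_infinite_limit F" for F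
    using not_has_finite_and_infinite_limit by blast
  show ?thesis
    unfolding Q1 Q2 large_def
    by (intro conjI impI ex) (use fin1 fin2 inf1 inf2 excl in blast)+
qed

end
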